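(* Let $n>1$. Let $J^\alpha$ be a family of operators defined for functions $f:(0,\infty)^n\rightarrow\mathbb{R}$ in $\mathcal{L}$ and $\alpha\in[0,\infty)^n$, such that $J^\alpha:\mathcal{L}\rightarrow\mathcal{L}$ is linear and continuous for $\|\cdot\|_{\mathrm{L}^1(0,T)}$ and any $T\in(0,\infty)^n$. Suppose: - Identity: for all $i\in\{1,\ldots,n\}$, $J^{e_i}=I^{e_i}$ on $\mathcal{L}$, where $e_i$ is the $i$th canonical vector of $\mathbb{R}^n$; - Index law: $J^{\alpha+\beta}=J^\alpha\circ J^\beta$ on $\mathcal{L}$ for all $\alpha,\beta\in[0,\infty)^n$; - Continuity: for all $x\in(0,\infty)^n$, the map $\alpha\mapsto\widehat{J^\alpha 1}(x)$ from $(0,\infty)^n$ to $\mathbb{R}$ is continuous at one point. Then $J^\alpha=I^\alpha$ is the multidimensional Riemann-Liouville integral on $\mathcal{L}$, for all $\alpha\in[0,\infty)^n$.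
   Context: $\mathcal{L}$ is the set of Laplace transformable functions $f:(0,\infty)^n\to\mathbb{R}$, i.e. those for which $\widehat{f}(x):=\int_{(0,\infty)^n}f(s)\mathrm{e}^{-s\cdot x}\,\mathrm{d}s$ is well-defined (as a Lebesgue integral) for all $x\in(0,\infty)^n$; in particular $f\in\mathrm{L}^1(0,T)$ for every box $(0,T)=(0,T_1)\times\cdots\times(0,T_n)$ with $T\in(0,\infty)^n$. The hat denotes this Laplace transform; $1$ is the constant function. Continuity of $J^\alpha$ for $\|\cdot\|_{\mathrm{L}^1(0,T)}$ means that $\|J^\alpha f_1-J^\alpha f_2\|_{\mathrm{L}^1(0,T)}\to0$ when $f_1,f_2\in\mathcal{L}$ and $\|f_1-f_2\|_{\mathrm{L}^1(0,T)}\to0$. For $\alpha\in[0,\infty)^n$, $I^\alpha$ is the Riemann-Liouville integral of multiorder $\alpha$ with left origin $(0,\ldots,0)$: the composition over $i$ of the one-dimensional operators $\frac{1}{\Gamma(\alpha_i)}\int_0^{t_i}(t_i-s_i)^{\alpha_i-1}f(\ldots,s_i,\ldots)\,\mathrm{d}s_i$ in the $i$th variable (the identity in that variable if $\alpha_i=0$). Functions are identified when equal almost everywhere. *)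

theory Defs
  imports "HOL-Analysis.Analysis"
begin

text \<open>
  A function on the open orthant is represented by a total function on \<open>real ^ 'n\<close> whose
  values outside the orthant are irrelevant; the identification of functions that agree
  almost everywhere is the relation \<open>ae_eq\<close>.
\<close>

definition pos_orthant :: "(real ^ 'n) set" where
  "pos_orthant = {x. \<forall>i. 0 < x $ i}"

definition nonneg_orthant :: "(real ^ 'n) set" where
  "nonneg_orthant = {x. \<forall>i. 0 \<le> x $ i}"

definition ae_eq :: "(real ^ 'n::finite \<Rightarrow> real) \<Rightarrow> (real ^ 'n \<Rightarrow> real) \<Rightarrow> bool" where
  "ae_eq f g \<longleftrightarrow> (AE t\<in>pos_orthant in lebesgue. f t = g t)"

definition laplace_transformable :: "(real ^ 'n::finite \<Rightarrow> real) set" where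
  "laplace_transformable =
     {f. \<forall>x\<in>pos_orthant. (\<lambda>s. f s * exp (- (s \<bullet> x))) absolutely_integrable_on pos_orthant}"

definition laplace :: "(real ^ 'n::finite \<Rightarrow> real) \<Rightarrow> real ^ 'n \<Rightarrow> real" where
  "laplace f x = (LINT s:pos_orthant|lebesgue. f s * exp (- (s \<bullet> x)))"

definition L1_norm :: "real ^ 'n::finite \<Rightarrow> (real ^ 'n \<Rightarrow> real) \<Rightarrow> real" where
  "L1_norm T f = (LINT t:box 0 T|lebesgue. \<bar>f t\<bar>)"

definition RL_coord :: "'n::finite \<Rightarrow> real \<Rightarrow> (real ^ 'n \<Rightarrow> real) \<Rightarrow> real ^ 'n \<Rightarrow> real" where
  "RL_coord i a f t =
     (if a = 0 then f t
      else 1 / Gamma a *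
        (LINT s:{0<..<t $ i}|lebesgue.
           (t $ i - s) powr (a - 1) * f (\<chi> j. if j = i then s else t $ j)))"

text \<open>
  The linear order on the index type only fixes the order of composition, with the smallest
  index outermost; up to \<open>ae_eq\<close> the result on \<open>laplace_transformable\<close> does not depend on it
  (Fubini). For almost every \<open>t\<close> the integrals involved exist; on the remaining null set the
  value is arbitrary.
\<close>

definition riemann_liouville ::
    "(real, 'n::{finite, linorder}) vec \<Rightarrow> ((real, 'n) vec \<Rightarrow> real) \<Rightarrow> (real, 'n) vec \<Rightarrow> real" where
  "riemann_liouville \<alpha> = foldr (\<lambda>i. RL_coord i (\<alpha> $ i)) (sorted_list_of_set UNIV)"

end

theory Submission
  imports Defs
begin

text \<open>
  Each \<open>J \<alpha>\<close> commutes with the integrations \<open>J e\<^sub>i\<close>, so on monomials, which are iterated integrals of \<open>1\<close>, it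
  acts on Laplace transforms as multiplication by \<open>J_factor \<alpha> x\<close>, the quotient of the transforms of \<open>J \<alpha> 1\<close> and \<open>1\<close>.
  Equivalently \<open>1 * J \<alpha> p = J \<alpha> 1 * p\<close> (convolutions) for polynomials \<open>p\<close>; density of the polynomials in
  \<open>L\<^sup>1\<close> of a box and continuity of \<open>J \<alpha>\<close> extend this to all transformable functions. By the index law this factor is
  multiplicative in \<open>\<alpha>\<close>, and it is \<open>1 / x\<^sub>i\<close> at \<open>e\<^sub>i\<close>; being continuous at one point it is
  \<open>\<Prod>i. x\<^sub>i powr - \<alpha>\<^sub>i\<close>, the multiplier of the Riemann-Liouville integral. Uniqueness of the Laplace
  transform concludes.
\<close>

section \<open>Convolution along a shift\<close>

text \<open>Mean convergence on boxes does not control the Laplace transform, which sees the whole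
  orthant, so the multiplier identity cannot be passed to the limit from polynomials directly.
  Convolution is causal: on a box with corner \<open>0\<close> it depends only on the values of both
  factors there. The limit is therefore taken in the convolution identity, and transforms are taken
  again afterwards. Convolving with \<open>1\<close> clears a denominator:
  \<open>J_factor \<alpha>\<close> itself need not be the transform of a function (for the identity
  operator it is constantly \<open>1\<close>), whereas its numerator and denominator are. Extending
  from polynomials to every transformable function is indispensable already for the index law, which
  applies \<open>J \<alpha>\<close> to \<open>J \<beta> 1\<close>. Continuity is given at some point
  only, and that point may depend on \<open>x\<close>. Dividing by the value of the factor there
  moves it to \<open>0\<close> along each axis, where Cauchy's exponential equation is solved one
  coordinate at a time.\<close>

lemma lborel_translation:
  fixes F :: "'a::euclidean_space \<Rightarrow> real"
  shows integrable_lborel_translation: "integrable lborel F \<Longrightarrow> integrable lborel (\<lambda>t. F (t - c))"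
    and integral_lborel_translation:
      "F \<in> borel_measurable borel \<Longrightarrow> (\<integral>t. F (t - c) \<partial>lborel) = (\<integral>t. F t \<partial>lborel)"
proof -
  have d: "distr lborel borel (\<lambda>t. t - c) = (lborel :: 'a measure)"
    using lborel_distr_plus[of "-c"] by (simp add: fun_eq_iff cong: distr_cong)
  show "integrable lborel F \<Longrightarrow> integrable lborel (\<lambda>t. F (t - c))"
    using integrable_distr_eq[of "\<lambda>t. t - c" lborel borel F] d
    by (simp add: borel_measurable_integrable)
  show "(\<integral>t. F (t - c) \<partial>lborel) = (\<integral>t. F t \<partial>lborel)" if "F \<in> borel_measurable borel"
    using integral_distr[of "\<lambda>t. t - c" lborel borel F] d that by simp
qed

text \<open>
  With \<open>\<phi> s = s\<close> this is convolution, with \<open>\<phi> s = s e\<^sub>i\<close> integration in the \<open>i\<close>th coordinate only; the common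
  form avoids slicing \<open>real ^ 'n\<close> into a product.
\<close>
definition shift_conv ::
    "('b::euclidean_space \<Rightarrow> real) \<Rightarrow> ('b \<Rightarrow> 'a::euclidean_space) \<Rightarrow> ('a \<Rightarrow> real) \<Rightarrow> 'a \<Rightarrow> real" where
  "shift_conv k \<phi> F t = (\<integral>s. k s * F (t - \<phi> s) \<partial>lborel)"

lemma integrable_shift_kernel:
  fixes \<phi> :: "'b::euclidean_space \<Rightarrow> 'a::euclidean_space" and k :: "'b \<Rightarrow> real" and F :: "'a \<Rightarrow> real"
  assumes k: "integrable lborel k" and F: "integrable lborel F"
    and \<phi>: "\<phi> \<in> borel_measurable borel"
  shows "integrable (lborel \<Otimes>\<^sub>M lborel) (\<lambda>(s, t). k s * F (t - \<phi> s))"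
proof -
  have P: "pair_sigma_finite (lborel :: 'b measure) (lborel :: 'a measure)" ..
  show ?thesis
  proof (rule pair_sigma_finite.Fubini_integrable[OF P])
    have [measurable]: "k \<in> borel_measurable borel" "F \<in> borel_measurable borel" "\<phi> \<in> borel_measurable borel"
      using k F \<phi> by (auto dest: borel_measurable_integrable)
    show "(\<lambda>(s, t). k s * F (t - \<phi> s)) \<in> borel_measurable (lborel \<Otimes>\<^sub>M lborel)"
      by measurable
    have "(\<integral>t. norm (k s * F (t - \<phi> s)) \<partial>lborel) = \<bar>k s\<bar> * (\<integral>t. \<bar>F t\<bar> \<partial>lborel)" for s
      using integral_lborel_translation[of "\<lambda>t. \<bar>F t\<bar>" "\<phi> s"] by (simp add: abs_mult)
    then show "integrable lborel (\<lambda>s. \<integral>t. norm (case (s, t) of (s, t) \<Rightarrow> k s * F (t - \<phi> s)) \<partial>lborel)"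
      using k by (simp add: integrable_abs)
    show "AE s in lborel. integrable lborel (\<lambda>t. case (s, t) of (s, t) \<Rightarrow> k s * F (t - \<phi> s))"
      using integrable_lborel_translation[OF F] by simp
  qed
qed

text \<open>Fubini for the kernel above: each inner integral over \<open>t\<close> is a translate of
  \<open>F\<close>, so the total mass is the product of the two masses. The first claim is the a.e.
  existence of the integral defining \<open>shift_conv\<close>.\<close>

lemma shift_conv:
  fixes \<phi> :: "'b::euclidean_space \<Rightarrow> 'a::euclidean_space" and k :: "'b \<Rightarrow> real" and F :: "'a \<Rightarrow> real"
  assumes k: "integrable lborel k" and F: "integrable lborel F"
    and \<phi>: "\<phi> \<in> borel_measurable borel"
  shows AE_integrable_shift_conv: "AE t in lborel. integrable lborel (\<lambda>s. k s * F (t - \<phi> s))"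
    and integrable_shift_conv: "integrable lborel (shift_conv k \<phi> F)"
    and integral_shift_conv:
      "(\<integral>t. shift_conv k \<phi> F t \<partial>lborel) = (\<integral>s. k s \<partial>lborel) * (\<integral>t. F t \<partial>lborel)"
proof -
  have P: "pair_sigma_finite (lborel :: 'b measure) (lborel :: 'a measure)" ..
  note I = integrable_shift_kernel[OF k F \<phi>]
  have [measurable]: "F \<in> borel_measurable borel" using F by (auto dest: borel_measurable_integrable)
  show "AE t in lborel. integrable lborel (\<lambda>s. k s * F (t - \<phi> s))"
    using pair_sigma_finite.AE_integrable_snd[OF P I] .
  show "integrable lborel (shift_conv k \<phi> F)"
    unfolding shift_conv_def[abs_def] using pair_sigma_finite.integrable_snd[OF P I] .
  show "(\<integral>t. shift_conv k \<phi> F t \<partial>lborel) = (\<integral>s. k s \<partial>lborel) * (\<integral>t. F t \<partial>lborel)"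
    unfolding shift_conv_def[abs_def] using pair_sigma_finite.Fubini_integral[OF P I]
    by (simp add: integral_lborel_translation)
qed

text \<open>The weight splits along \<open>t = \<phi> s + (t - \<phi> s)\<close>. This brings
  functions that are integrable only after weighting under the mean-integrable theory. Both sides
  integrate the same function of \<open>s\<close>, so no integrability is required.\<close>

lemma shift_conv_exp_weight:
  "shift_conv k \<phi> F t * exp (- (t \<bullet> x)) =
    shift_conv (\<lambda>s. k s * exp (- (\<phi> s \<bullet> x))) \<phi> (\<lambda>t. F t * exp (- (t \<bullet> x))) t"
  unfolding shift_conv_def
  by (subst integral_mult_left_zero[symmetric], rule Bochner_Integration.integral_cong)
     (auto simp: inner_diff_left mult_exp_exp ac_simps exp_diff exp_minus field_simps)

section \<open>Borel representatives\<close>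

text \<open>Borel measurability survives composition with \<open>t - \<phi> s\<close>, as Fubini
  requires, while Lebesgue measurability in general does not. Vanishing off the orthant lets all
  integrals run over the whole space and produces the limits of integration of a convolution
  automatically.\<close>

definition orthant_laplace_fun :: "(real ^ 'n::finite \<Rightarrow> real) set" where
  "orthant_laplace_fun = {F. F \<in> borel_measurable borel \<and> (\<forall>t. t \<notin> pos_orthant \<longrightarrow> F t = 0) \<and>
     (\<forall>x\<in>pos_orthant. integrable lborel (\<lambda>t. F t * exp (- (t \<bullet> x))))}"

lemma pos_orthant_borel [measurable]: "(pos_orthant :: (real^'n::finite) set) \<in> sets borel"
proof -
  have "pos_orthant = (\<Inter>i. {x::real^'n. 0 < x $ i})" by (auto simp: pos_orthant_def)
  also have "open \<dots>" by (intro open_INT) (auto intro!: open_Collect_less continuous_intros)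
  finally show ?thesis by (rule borel_open)
qed

lemma ae_eq_lborel: "ae_eq f g \<longleftrightarrow> (AE t in lborel. t \<in> pos_orthant \<longrightarrow> f t = g t)"
  unfolding ae_eq_def by (simp add: AE_completion_iff)

lemma ae_eq_sym: "ae_eq f g \<Longrightarrow> ae_eq g f" unfolding ae_eq_def by (auto elim: eventually_mono)
lemma ae_eq_trans [trans]: "ae_eq f g \<Longrightarrow> ae_eq g h \<Longrightarrow> ae_eq f h"
  unfolding ae_eq_def by (rule eventually_elim2[of "\<lambda>t. t \<in> pos_orthant \<longrightarrow> f t = g t" _ "\<lambda>t. t \<in> pos_orthant \<longrightarrow> g t = h t"]) auto

text \<open>The bridge between the definitions of the theorem, which integrate against
  \<open>lebesgue\<close>, and Fubini and translation arguments, which live on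
  \<open>lborel\<close>.\<close>

lemma integral_lebesgue_cong:
  fixes f g :: "'a::euclidean_space \<Rightarrow> real"
  assumes g: "g \<in> borel_measurable lborel" and ae: "AE x in lborel. f x = g x"
  shows "f \<in> borel_measurable lebesgue"
    and "integrable lebesgue f \<longleftrightarrow> integrable lborel g"
    and "integral\<^sup>L lebesgue f = integral\<^sup>L lborel g"
proof -
  have g': "g \<in> borel_measurable lebesgue" using g by (rule measurable_completion)
  have ae': "AE x in lebesgue. f x = g x" using ae by (rule AE_completion)
  show f: "f \<in> borel_measurable lebesgue"
    using ae' by (intro borel_measurable_AE[OF g']) (auto elim: eventually_mono)
  show "integrable lebesgue f \<longleftrightarrow> integrable lborel g"
    using integrable_cong_AE[OF f g' ae'] integrable_completion[OF g] by simp
  show "integral\<^sup>L lebesgue f = integral\<^sup>L lborel g"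
    using integral_cong_AE[OF f g' ae'] integral_completion[OF g] by simp
qed

lemma laplace_representative:
  fixes f :: "real ^ 'n::finite \<Rightarrow> real"
  assumes F: "F \<in> orthant_laplace_fun" and fF: "ae_eq f F"
  shows "f \<in> laplace_transformable"
    and "laplace f x = (\<integral>t. F t * exp (- (t \<bullet> x)) \<partial>lborel)"
proof -
  have [measurable]: "F \<in> borel_measurable borel" using F by (simp add: orthant_laplace_fun_def)
  have ae: "AE t in lborel. indicator pos_orthant t *\<^sub>R (f t * exp (- (t \<bullet> x))) = F t * exp (- (t \<bullet> x))" for x
    using fF[unfolded ae_eq_lborel] by (rule eventually_mono) (use F in \<open>auto simp: orthant_laplace_fun_def indicator_def\<close>)
  have m: "(\<lambda>t. F t * exp (- (t \<bullet> x))) \<in> borel_measurable lborel" for x by measurable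
  note c = integral_lebesgue_cong[OF m ae]
  show "f \<in> laplace_transformable"
    unfolding laplace_transformable_def set_integrable_def using c(2) F by (auto simp: orthant_laplace_fun_def)
  show "laplace f x = (\<integral>t. F t * exp (- (t \<bullet> x)) \<partial>lborel)"
    unfolding laplace_def set_lebesgue_integral_def by (rule c(3))
qed

text \<open>Only weighted products with \<open>f\<close> are known to be measurable. One weight, at
  the point with all coordinates \<open>1\<close>, is fixed; a Borel version of that product is
  taken and the weight divided out again.\<close>

lemma laplace_representative_exists:
  fixes f :: "real ^ 'n::finite \<Rightarrow> real"
  assumes f: "f \<in> laplace_transformable"
  obtains F where "F \<in> orthant_laplace_fun" "ae_eq f F"
proof -
  have one: "(\<chi> i. 1) \<in> (pos_orthant :: (real^'n) set)" by (simp add: pos_orthant_def)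
  have "(\<lambda>t. indicator pos_orthant t *\<^sub>R (f t * exp (- (t \<bullet> (\<chi> i. 1))))) \<in> borel_measurable (completion lborel)"
    using f one unfolding laplace_transformable_def set_integrable_def by (blast dest: borel_measurable_integrable)
  from completion_ex_borel_measurable_real[OF this] obtain G where G[measurable]: "G \<in> borel_measurable borel"
    and ae: "AE t in lborel. indicator pos_orthant t *\<^sub>R (f t * exp (- (t \<bullet> (\<chi> i. 1)))) = G t" by auto
  define F where "F t = indicator pos_orthant t * (G t * exp (t \<bullet> (\<chi> i. 1)))" for t
  have Fm[measurable]: "F \<in> borel_measurable borel" unfolding F_def by measurable
  have fF: "AE t in lborel. indicator pos_orthant t * f t = F t"
    using ae by eventually_elim (auto simp: F_def indicator_def exp_minus field_simps)
  have ae2: "AE t in lborel. indicator pos_orthant t *\<^sub>R (f t * exp (- (t \<bullet> x))) = F t * exp (- (t \<bullet> x))" for x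
    using fF by eventually_elim (auto simp: indicator_def split: if_splits)
  have m: "(\<lambda>t. F t * exp (- (t \<bullet> x))) \<in> borel_measurable lborel" for x by measurable
  show ?thesis
  proof
    show "F \<in> orthant_laplace_fun"
      unfolding orthant_laplace_fun_def
      using f integral_lebesgue_cong(2)[OF m ae2]
      by (auto simp: laplace_transformable_def set_integrable_def) (auto simp: F_def)
    show "ae_eq f F" unfolding ae_eq_lborel using fF by eventually_elim (auto simp: indicator_def)
  qed
qed

section \<open>Density of polynomials\<close>

text \<open>Stone-Weierstrass on \<open>K\<close> handles continuous functions; distance functions
  give open sets, outer regularity gives Borel sets, and induction over integrable functions the
  rest. The measure is general because the lemma serves twice: for Lebesgue measure on a box, and
  for an image measure on the unit cube in the uniqueness proof.\<close>

lemma polynomial_dense_L1: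
  fixes G :: "'a::euclidean_space \<Rightarrow> real"
  assumes "finite_measure M" and sets_M: "sets M = sets borel"
    and K: "compact K" "AE x in M. x \<in> K"
    and G: "integrable M G" and "\<epsilon> > 0"
  shows "\<exists>p. real_polynomial_function p \<and> integrable M p \<and> (\<integral>x. \<bar>G x - p x\<bar> \<partial>M) < \<epsilon>"
proof -
  interpret finite_measure M by fact
  note [measurable_cong] = sets_M
  have space_M: "space M = UNIV" using sets_eq_imp_space_eq[OF sets_M] by simp
  define AP where "AP G \<longleftrightarrow> integrable M G \<and>
    (\<forall>\<epsilon>>0. \<exists>p. real_polynomial_function p \<and> integrable M p \<and> (\<integral>x. \<bar>G x - p x\<bar> \<partial>M) < \<epsilon>)"
    for G :: "'a \<Rightarrow> real"
  have cont_int: "integrable M \<psi>" if "continuous_on UNIV \<psi>" for \<psi> :: "'a \<Rightarrow> real"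
  proof -
    have "compact (\<psi> ` K)"
      using that K(1) by (intro compact_continuous_image) (auto intro: continuous_on_subset)
    then obtain B where "\<And>x. x \<in> K \<Longrightarrow> norm (\<psi> x) \<le> B"
      by (metis bounded_iff compact_imp_bounded image_eqI)
    moreover have "\<psi> \<in> borel_measurable M"
      using borel_measurable_continuous_onI[OF that] by measurable
    ultimately show ?thesis using K(2) by (intro integrable_const_bound[of \<psi> B]) auto
  qed
  have poly_int: "integrable M p" if "real_polynomial_function p" for p
    using that by (intro cont_int) (simp add: continuous_on_polymonial_function real_polynomial_function_eq)
  \<comment> \<open>The closure of the polynomials is closed: every later extension step only has to
    approximate by members of \<open>AP\<close>.\<close>
  have AP_lim: "AP G" if G: "integrable M G"
    and lim: "\<And>\<epsilon>. \<epsilon> > 0 \<Longrightarrow> \<exists>G'. AP G' \<and> (\<integral>x. \<bar>G x - G' x\<bar> \<partial>M) < \<epsilon>" for G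
    unfolding AP_def
  proof (intro conjI allI impI)
    fix \<epsilon> :: real assume "\<epsilon> > 0"
    then obtain G' where G': "AP G'" "(\<integral>x. \<bar>G x - G' x\<bar> \<partial>M) < \<epsilon>/2"
      using lim[of "\<epsilon>/2"] by auto
    then obtain p where p: "real_polynomial_function p" "integrable M p" "(\<integral>x. \<bar>G' x - p x\<bar> \<partial>M) < \<epsilon>/2"
      using \<open>\<epsilon> > 0\<close> unfolding AP_def by (metis half_gt_zero)
    have i: "integrable M G'" using G' by (simp add: AP_def)
    have "(\<integral>x. \<bar>G x - p x\<bar> \<partial>M) \<le> (\<integral>x. \<bar>G x - G' x\<bar> + \<bar>G' x - p x\<bar> \<partial>M)"
      using G i p(2) by (intro integral_mono) auto
    also have "\<dots> < \<epsilon>" using G i p G' by (subst Bochner_Integration.integral_add) auto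
    finally show "\<exists>p. real_polynomial_function p \<and> integrable M p \<and> (\<integral>x. \<bar>G x - p x\<bar> \<partial>M) < \<epsilon>"
      using p by auto
  qed fact
  have AP_cont: "AP \<psi>" if \<psi>: "continuous_on UNIV \<psi>" for \<psi>
    unfolding AP_def
  proof (intro conjI allI impI)
    show i: "integrable M \<psi>" using \<psi> by (rule cont_int)
    fix \<epsilon> :: real assume \<epsilon>: "\<epsilon> > 0"
    define m where "m = measure M (space M)"
    have m: "m \<ge> 0" by (simp add: m_def)
    \<comment> \<open>The uniform error is divided by the total mass; adding \<open>1\<close> covers
      the zero measure and makes the final inequality strict.\<close>
    obtain p where p: "real_polynomial_function p" "\<And>x. x \<in> K \<Longrightarrow> \<bar>\<psi> x - p x\<bar> < \<epsilon> / (m + 1)"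
      using Stone_Weierstrass_real_polynomial_function[OF K(1) continuous_on_subset[OF \<psi>], of "\<epsilon> / (m + 1)"] \<epsilon> m
      by auto
    have "(\<integral>x. \<bar>\<psi> x - p x\<bar> \<partial>M) \<le> (\<integral>x. \<epsilon> / (m + 1) \<partial>M)"
      using i poly_int[OF p(1)] K(2) by (intro integral_mono_AE) (auto intro: less_imp_le p(2))
    also have "\<dots> = \<epsilon> * (m / (m + 1))" by (simp add: m_def)
    also have "\<dots> < \<epsilon>" using \<epsilon> m by (simp add: field_simps)
    finally show "\<exists>p. real_polynomial_function p \<and> integrable M p \<and> (\<integral>x. \<bar>\<psi> x - p x\<bar> \<partial>M) < \<epsilon>"
      using p poly_int by auto
  qed
  have AP_open: "AP (indicator U)" if U: "open U" for U
  \<comment> \<open>For \<open>U = UNIV\<close> the complement is empty and \<open>infdist\<close>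
    to it is \<open>0\<close> by convention, so the functions \<open>\<psi>\<close> below would
    vanish identically.\<close>
  proof (cases "U = UNIV")
    case True then show ?thesis by (intro AP_cont) auto
  next
    case False
    define \<psi> where "\<psi> m x = min 1 (real m * infdist x (- U))" for m :: nat and x
    have \<psi>: "continuous_on UNIV (\<psi> m)" for m unfolding \<psi>_def by (intro continuous_intros)
    have \<psi>_lim: "(\<lambda>m. \<bar>indicator U x - \<psi> m x\<bar>) \<longlonglongrightarrow> 0" for x
    proof (cases "x \<in> U")
      case True
      then have d: "infdist x (- U) > 0"
        using U False by (intro infdist_pos_not_in_closed) (auto simp: closed_def)
      have "eventually (\<lambda>m. 1 / infdist x (- U) \<le> real m) sequentially"
        using eventually_ge_at_top[of "nat \<lceil>1 / infdist x (- U)\<rceil>"] by eventually_elim linarith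
      then have "eventually (\<lambda>m. \<bar>indicator U x - \<psi> m x\<bar> = 0) sequentially"
        by eventually_elim (use d True in \<open>auto simp: \<psi>_def field_simps\<close>)
      then show ?thesis by (rule tendsto_eventually)
    qed (simp add: \<psi>_def)
    have "(\<lambda>m. \<integral>x. \<bar>indicator U x - \<psi> m x\<bar> \<partial>M) \<longlonglongrightarrow> (\<integral>x. 0 \<partial>M)"
    proof (rule integral_dominated_convergence[where w = "\<lambda>_. 1"])
      show "(\<lambda>x. \<bar>indicator U x - \<psi> m x\<bar>) \<in> borel_measurable M" for m
        using U borel_measurable_integrable[OF cont_int[OF \<psi>[of m]]]
        by (intro borel_measurable_abs borel_measurable_diff borel_measurable_indicator) auto
      show "AE x in M. norm \<bar>indicator U x - \<psi> m x\<bar> \<le> 1" for m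
        by (auto simp: \<psi>_def indicator_def infdist_nonneg)
    qed (auto intro: \<psi>_lim)
    then have lim: "(\<lambda>m. \<integral>x. \<bar>indicator U x - \<psi> m x\<bar> \<partial>M) \<longlonglongrightarrow> 0" by simp
    show ?thesis
    proof (rule AP_lim)
      show "integrable M (indicat_real U)" using U by (intro integrable_real_indicator) (auto simp: less_top[symmetric])
      fix \<epsilon> :: real assume "\<epsilon> > 0"
      then have "\<exists>m. (\<integral>x. \<bar>indicator U x - \<psi> m x\<bar> \<partial>M) < \<epsilon>"
        using order_tendstoD(2)[OF lim, of \<epsilon>] by (auto simp: eventually_sequentially)
      then show "\<exists>G'. AP G' \<and> (\<integral>x. \<bar>indicator U x - G' x\<bar> \<partial>M) < \<epsilon>"
        using AP_cont[OF \<psi>] by blast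
    qed
  qed
  have AP_sets: "AP (indicator A)" if A: "A \<in> sets M" for A
  proof (rule AP_lim)
    show "integrable M (indicat_real A)" using A by (intro integrable_real_indicator) (auto simp: less_top[symmetric])
    fix \<epsilon> :: real assume \<epsilon>: "\<epsilon> > 0"
    have "emeasure M A = (INF U \<in> {U. A \<subseteq> U \<and> open U}. emeasure M U)"
      using outer_regular[of M A] A sets_M emeasure_finite by auto
    moreover have "emeasure M A < emeasure M A + ennreal \<epsilon>"
      using \<epsilon> by (simp add: less_top ennreal_add_left_cancel_less)
    ultimately obtain U where U: "A \<subseteq> U" "open U" "emeasure M U < emeasure M A + ennreal \<epsilon>"
      by (auto simp: INF_less_iff)
    have Um: "U \<in> sets M" using U by simp
    have "measure M U < measure M A + \<epsilon>"
      using U(3) \<epsilon> by (simp add: emeasure_eq_measure ennreal_plus[symmetric] ennreal_less_iff del: ennreal_plus)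
    moreover have "(\<integral>x. \<bar>indicat_real A x - indicator U x\<bar> \<partial>M) = (\<integral>x. indicat_real (U - A) x \<partial>M)"
      using U(1) by (intro Bochner_Integration.integral_cong) (auto simp: indicator_def)
    moreover have "\<dots> = measure M U - measure M A"
      using finite_measure_Diff[OF Um A U(1)] by (simp add: space_M)
    ultimately show "\<exists>G'. AP G' \<and> (\<integral>x. \<bar>indicator A x - G' x\<bar> \<partial>M) < \<epsilon>"
      using AP_open[OF U(2)] by (intro exI[of _ "indicator U"]) auto
  qed
  have AP_add: "AP (\<lambda>x. f x + g x)" if f: "AP f" and g: "AP g" for f g
    unfolding AP_def
  proof (intro conjI allI impI)
    show "integrable M (\<lambda>x. f x + g x)" using f g by (auto simp: AP_def)
    fix \<epsilon> :: real assume "\<epsilon> > 0"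
    then obtain p q where p: "real_polynomial_function p" "integrable M p" "(\<integral>x. \<bar>f x - p x\<bar> \<partial>M) < \<epsilon>/2"
      and q: "real_polynomial_function q" "integrable M q" "(\<integral>x. \<bar>g x - q x\<bar> \<partial>M) < \<epsilon>/2"
      using f g unfolding AP_def by (meson half_gt_zero)
    have i: "integrable M f" "integrable M g" using f g by (auto simp: AP_def)
    have "(\<integral>x. \<bar>(f x + g x) - (p x + q x)\<bar> \<partial>M) \<le> (\<integral>x. \<bar>f x - p x\<bar> + \<bar>g x - q x\<bar> \<partial>M)"
      using i p q by (intro integral_mono) auto
    also have "\<dots> < \<epsilon>" using i p q by (subst Bochner_Integration.integral_add) auto
    finally show "\<exists>p. real_polynomial_function p \<and> integrable M p \<and> (\<integral>x. \<bar>f x + g x - p x\<bar> \<partial>M) < \<epsilon>"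
      using p q by (intro exI[of _ "\<lambda>x. p x + q x"]) auto
  qed
  have AP_scale: "AP (\<lambda>x. f x * c)" if f: "AP f" for f c
    unfolding AP_def
  proof (intro conjI allI impI)
    show "integrable M (\<lambda>x. f x * c)" using f by (auto simp: AP_def)
    fix \<epsilon> :: real assume \<epsilon>: "\<epsilon> > 0"
    then have "\<epsilon> / (\<bar>c\<bar> + 1) > 0" by (intro divide_pos_pos) auto
    then obtain p where p: "real_polynomial_function p" "integrable M p" "(\<integral>x. \<bar>f x - p x\<bar> \<partial>M) < \<epsilon> / (\<bar>c\<bar> + 1)"
      using f unfolding AP_def by blast
    have "(\<integral>x. \<bar>f x * c - p x * c\<bar> \<partial>M) = (\<integral>x. \<bar>f x - p x\<bar> \<partial>M) * \<bar>c\<bar>"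
      by (simp add: left_diff_distrib[symmetric] abs_mult)
    also have "\<dots> \<le> \<epsilon> / (\<bar>c\<bar> + 1) * \<bar>c\<bar>" using p by (intro mult_right_mono) auto
    also have "\<dots> < \<epsilon>" using \<epsilon> by (simp add: field_simps)
    finally show "\<exists>p. real_polynomial_function p \<and> integrable M p \<and> (\<integral>x. \<bar>f x * c - p x\<bar> \<partial>M) < \<epsilon>"
      using p by (intro exI[of _ "\<lambda>x. p x * c"]) auto
  qed
  from G have "AP G"
  proof induction
    case (base A c) then show ?case using AP_scale[OF AP_sets, of A c] by simp
  next
    case (add f g) then show ?case by (intro AP_add)
  next
    case (lim f s)
    have "(\<lambda>i. \<integral>x. \<bar>f x - s i x\<bar> \<partial>M) \<longlonglongrightarrow> (\<integral>x. 0 \<partial>M)"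
    \<comment> \<open>The simple approximants satisfy
      \<open>\<bar>s i x\<bar> \<le> 2 * \<bar>f x\<bar>\<close>, which gives the factor
      \<open>3\<close> for the difference.\<close>
    proof (rule integral_dominated_convergence[where w = "\<lambda>x. 3 * \<bar>f x\<bar>"])
      show "AE x in M. (\<lambda>i. \<bar>f x - s i x\<bar>) \<longlonglongrightarrow> 0"
      proof (rule AE_I2)
        fix x assume "x \<in> space M"
        from tendsto_rabs[OF tendsto_diff[OF tendsto_const lim(2)[OF this], of "f x"]]
        show "(\<lambda>i. \<bar>f x - s i x\<bar>) \<longlonglongrightarrow> 0" by simp
      qed
      show "AE x in M. norm \<bar>f x - s i x\<bar> \<le> 3 * \<bar>f x\<bar>" for i
        using lim(3)[of _ i] by (intro AE_I2) (force simp: abs_if split: if_splits)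
    qed (use lim in auto)
    then have "(\<lambda>i. \<integral>x. \<bar>f x - s i x\<bar> \<partial>M) \<longlonglongrightarrow> 0" by simp
    from order_tendstoD(2)[OF this] show ?case
      using lim by (intro AP_lim) (simp_all add: eventually_sequentially, meson order_refl)
  qed
  then show ?thesis using \<open>\<epsilon> > 0\<close> by (auto simp: AP_def)
qed

section \<open>Monomials and their linear span\<close>

definition monomial_fun :: "('n \<Rightarrow> nat) \<Rightarrow> real ^ 'n::finite \<Rightarrow> real" where
  "monomial_fun k t = (\<Prod>i\<in>UNIV. t $ i ^ k i)"

lemma monomial_fun_mult:
  "t $ i * monomial_fun k t = monomial_fun (k(i := Suc (k i))) t"
proof -
  have "monomial_fun (k(i := Suc (k i))) t = t $ i ^ Suc (k i) * (\<Prod>j\<in>UNIV - {i}. t $ j ^ (k(i := Suc (k i))) j)"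
    unfolding monomial_fun_def by (subst prod.remove[of _ i]) auto
  also have "(\<Prod>j\<in>UNIV - {i}. t $ j ^ (k(i := Suc (k i))) j) = (\<Prod>j\<in>UNIV - {i}. t $ j ^ k j)"
    by (intro prod.cong) auto
  also have "t $ i ^ Suc (k i) * \<dots> = t $ i * monomial_fun k t"
    unfolding monomial_fun_def by (subst (2) prod.remove[of _ i]) auto
  finally show ?thesis ..
qed

text \<open>The rules mirror the linearity hypotheses on \<open>J\<close>, so that a statement about
  \<open>J\<close> on monomials extends by induction. The polynomial functions of the library are
  built with products, which \<open>J\<close> does not respect.\<close>

inductive monomial_span :: "(real ^ 'n::finite \<Rightarrow> real) \<Rightarrow> bool" where
  mono: "monomial_span (monomial_fun k)"
| add: "monomial_span p \<Longrightarrow> monomial_span q \<Longrightarrow> monomial_span (\<lambda>t. p t + q t)"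
| scale: "monomial_span p \<Longrightarrow> monomial_span (\<lambda>t. c * p t)"

lemma monomial_span_zero: "monomial_span (\<lambda>t. 0)"
  using monomial_span.scale[OF monomial_span.mono, of 0] by simp

lemma monomial_span_sum:
  "finite A \<Longrightarrow> (\<And>k. k \<in> A \<Longrightarrow> monomial_span (f k)) \<Longrightarrow> monomial_span (\<lambda>t. \<Sum>k\<in>A. f k t)"
  by (induction A rule: finite_induct) (auto intro: monomial_span_zero monomial_span.add)

lemma monomial_span_linear_mult:
  assumes f: "bounded_linear f" and q: "monomial_span q"
  shows "monomial_span (\<lambda>t. f t * q t)"
  using q
proof induction
  case (mono k)
  interpret bounded_linear f by fact
  have "f t * monomial_fun k t = (\<Sum>i\<in>UNIV. f (axis i 1) * monomial_fun (k(i := Suc (k i))) t)" for t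
  proof -
    have "f t = f (\<Sum>i\<in>UNIV. t $ i *\<^sub>R axis i 1)"
      by (simp add: basis_expansion scalar_mult_eq_scaleR[symmetric])
    also have "\<dots> = (\<Sum>i\<in>UNIV. t $ i * f (axis i 1))" by (simp add: sum scaleR)
    finally have "f t * monomial_fun k t = (\<Sum>i\<in>UNIV. t $ i * f (axis i 1) * monomial_fun k t)"
      by (simp add: sum_distrib_right)
    also have "\<dots> = (\<Sum>i\<in>UNIV. f (axis i 1) * monomial_fun (k(i := Suc (k i))) t)"
      by (intro sum.cong refl) (simp add: monomial_fun_mult[symmetric] del: fun_upd_apply)
    finally show ?thesis .
  qed
  then show ?case by (auto intro!: monomial_span_sum monomial_span.mono monomial_span.scale)
next
  case (add p q) then show ?case by (simp add: distrib_left monomial_span.add)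
next
  case (scale p c) then show ?case using monomial_span.scale[of "\<lambda>t. f t * p t" c] by (simp add: mult_ac)
qed

lemma real_polynomial_function_monomial_span:
  fixes p :: "real ^ 'n::finite \<Rightarrow> real"
  assumes "real_polynomial_function p"
  shows "monomial_span p"
proof -
  \<comment> \<open>Carrying an arbitrary second factor \<open>q\<close> turns the product case into
    two applications of the induction hypothesis; \<open>q = 1\<close>, the monomial with zero
    exponents, recovers the claim.\<close>
  have "monomial_span (\<lambda>t. p t * q t)" if "monomial_span q" for q
    using assms that
  proof (induction arbitrary: q)
    case (linear f) then show ?case by (rule monomial_span_linear_mult)
  next
    case (const c) then show ?case by (rule monomial_span.scale)
  next
    case (add f g) then show ?case by (simp add: distrib_right monomial_span.add)
  next
    case (mult f g) then show ?case by (simp add: mult.assoc)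
  qed
  from this[OF monomial_span.mono, of "\<lambda>_. 0"] show ?thesis by (simp add: monomial_fun_def)
qed

section \<open>Uniqueness of the Laplace transform\<close>

text \<open>A monomial in the \<open>exp (- (t $ i))\<close> with exponents \<open>k\<close>, times
  the fixed weight, is the exponential weight at the point with coordinates \<open>1 + k i\<close>.
  The \<open>1\<close> keeps this point in the open orthant even when some exponent is
  \<open>0\<close>.\<close>

lemma exp_coordinates_polynomial:
  fixes F :: "real ^ 'n::finite \<Rightarrow> real"
  assumes F: "F \<in> orthant_laplace_fun"
    and zero: "\<And>x. x \<in> pos_orthant \<Longrightarrow> (\<integral>t. F t * exp (- (t \<bullet> x)) \<partial>lborel) = 0"
    and p: "real_polynomial_function p"
  shows "integrable lborel (\<lambda>t. F t * exp (- (t \<bullet> (\<chi> i. 1))) * p (\<chi> i. exp (- (t $ i)))) \<and>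
    (\<integral>t. F t * exp (- (t \<bullet> (\<chi> i. 1))) * p (\<chi> i. exp (- (t $ i))) \<partial>lborel) = 0"
  using real_polynomial_function_monomial_span[OF p]
proof induction
  case (mono k)
  have "exp (- (t \<bullet> (\<chi> i. 1))) * monomial_fun k (\<chi> i. exp (- (t $ i))) = exp (- (t \<bullet> (\<chi> i. 1 + real (k i))))" for t
    by (simp add: monomial_fun_def inner_vec_def exp_sum[symmetric] exp_of_nat_mult[symmetric] exp_add[symmetric]
        sum_negf[symmetric] sum.distrib[symmetric] algebra_simps)
  moreover have "(\<chi> i. 1 + real (k i)) \<in> (pos_orthant :: (real ^ 'n) set)" by (simp add: pos_orthant_def add_pos_nonneg)
  ultimately show ?case using F zero by (simp add: orthant_laplace_fun_def mult.assoc)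
next
  case (add p q) then show ?case by (simp add: distrib_left)
next
  case (scale p c)
  then show ?case
    using integrable_mult_right[of c lborel "\<lambda>t. F t * exp (- (t \<bullet> (\<chi> i. 1))) * p (\<chi> i. exp (- (t $ i)))"]
    by (simp add: mult.left_commute[of _ c])
qed

text \<open>
  Put \<open>u t = (exp (- t$1), \<dots>, exp (- t$n))\<close>. The Laplace transform at the points with positive integer
  coordinates shows that \<open>F t * exp (- (t \<bullet> 1))\<close> annihilates every polynomial in \<open>u t\<close>; as \<open>u\<close> is injective
  with values in a cube, polynomials in \<open>u\<close> approximate the sign of \<open>F\<close> in mean.
\<close>
lemma laplace_unique_zero:
  fixes F :: "real ^ 'n::finite \<Rightarrow> real"
  assumes F: "F \<in> orthant_laplace_fun"
    and zero: "\<And>x. x \<in> pos_orthant \<Longrightarrow> (\<integral>t. F t * exp (- (t \<bullet> x)) \<partial>lborel) = 0"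
  shows "AE t in lborel. F t = 0"
proof -
  define G where "G t = F t * exp (- (t \<bullet> (\<chi> i. 1)))" for t
  define u :: "real ^ 'n \<Rightarrow> real ^ 'n" where "u t = (\<chi> i. exp (- (t $ i)))" for t
  define v :: "real ^ 'n \<Rightarrow> real ^ 'n" where "v y = (\<chi> i. - ln (y $ i))" for y
  have one: "(\<chi> i. 1) \<in> (pos_orthant :: (real ^ 'n) set)" by (simp add: pos_orthant_def)
  have Fm[measurable]: "F \<in> borel_measurable borel" using F by (simp add: orthant_laplace_fun_def)
  have Gm[measurable]: "G \<in> borel_measurable borel" unfolding G_def by measurable
  have Gi: "integrable lborel G" using F one by (auto simp: orthant_laplace_fun_def G_def[abs_def])
  have [measurable]: "u \<in> borel_measurable borel"
    unfolding u_def by (intro borel_measurable_continuous_onI continuous_intros)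
  have [measurable]: "v \<in> borel_measurable borel"
    by (subst borel_measurable_euclidean_space) (auto simp: v_def Basis_vec_def inner_axis)
  have vu: "v (u t) = t" for t by (simp add: u_def v_def vec_eq_iff)
  \<comment> \<open>\<open>M\<close> is the image of the measure with density
    \<open>\<bar>G\<bar>\<close> under \<open>u\<close>: finite and carried by a cube, so mean
    approximation under \<open>M\<close> is approximation by polynomials in \<open>u t\<close> with
    weight \<open>\<bar>G t\<bar>\<close>.\<close>
  define D where "D = density lborel (\<lambda>t. ennreal \<bar>G t\<bar>)"
  define M where "M = distr D borel u"
  have fin: "finite_measure M"
  proof
    have "emeasure M (space M) = (\<integral>\<^sup>+t. ennreal \<bar>G t\<bar> \<partial>lborel)"
      unfolding M_def D_def by (simp add: emeasure_distr emeasure_density)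
    also have "\<dots> < \<infinity>" using Gi by (simp add: integrable_iff_bounded)
    finally show "emeasure M (space M) \<noteq> \<infinity>" by simp
  qed
  have int_M: "integrable M f \<longleftrightarrow> integrable lborel (\<lambda>t. \<bar>G t\<bar> * f (u t))"
    "integral\<^sup>L M f = (\<integral>t. \<bar>G t\<bar> * f (u t) \<partial>lborel)" if [measurable]: "f \<in> borel_measurable borel" for f :: "_ \<Rightarrow> real"
    unfolding M_def D_def
    by (subst integrable_distr_eq integral_distr, simp, simp, subst integrable_density integral_density, auto)+
  \<comment> \<open>As \<open>v\<close> is a Borel left inverse of \<open>u\<close>, the sign of
    \<open>G\<close> becomes a function of \<open>u t\<close>: this is where injectivity
    enters.\<close>
  define \<sigma> where "\<sigma> y = sgn (G (v y))" for y
  have [measurable]: "\<sigma> \<in> borel_measurable borel" unfolding \<sigma>_def by measurable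
  have \<sigma>: "integrable M \<sigma>"
  proof (rule finite_measure.integrable_const_bound[OF fin, of _ 1])
    show "AE x in M. norm (\<sigma> x) \<le> 1" by (simp add: \<sigma>_def sgn_real_def)
    show "\<sigma> \<in> borel_measurable M" by (simp add: M_def)
  qed
  \<comment> \<open>On the whole space \<open>u\<close> is unbounded; but \<open>G\<close> vanishes
    off the orthant, so only points \<open>t\<close> with positive coordinates carry mass.\<close>
  have AEK: "AE y in M. y \<in> cbox 0 (\<chi> i. 1)"
  proof -
    have "AE t in D. u t \<in> cbox 0 (\<chi> i. 1)"
      unfolding D_def using F
      by (subst AE_density) (auto intro!: AE_I2 simp: orthant_laplace_fun_def G_def u_def mem_box_cart pos_orthant_def
          less_imp_le, metis less_imp_le)
    then show ?thesis unfolding M_def by (subst AE_distr_iff) (auto simp: D_def)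
  qed
  have "(\<integral>t. \<bar>G t\<bar> \<partial>lborel) \<le> \<epsilon>" if "\<epsilon> > 0" for \<epsilon>
  proof -
    obtain p where p: "real_polynomial_function p" "integrable M p" "(\<integral>x. \<bar>\<sigma> x - p x\<bar> \<partial>M) < \<epsilon>"
      using polynomial_dense_L1[OF fin _ compact_cbox AEK \<sigma> \<open>\<epsilon> > 0\<close>] by (auto simp: M_def)
    have [measurable]: "p \<in> borel_measurable borel"
      using p(1) by (intro borel_measurable_continuous_onI)
        (simp add: continuous_on_polymonial_function real_polynomial_function_eq)
    have Gp: "integrable lborel (\<lambda>t. G t * p (u t))" "(\<integral>t. G t * p (u t) \<partial>lborel) = 0"
      using exp_coordinates_polynomial[OF F zero p(1)] by (auto simp: G_def u_def)
    have abs_G: "\<bar>G t\<bar> = G t * \<sigma> (u t)" for t by (simp add: \<sigma>_def vu abs_sgn)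
    \<comment> \<open>The subtracted integral is \<open>0\<close>, so the whole mass of
      \<open>G\<close> is bounded by the approximation error of \<open>\<sigma>\<close>.\<close>
    have "(\<integral>t. \<bar>G t\<bar> \<partial>lborel) = (\<integral>t. G t * \<sigma> (u t) \<partial>lborel) - (\<integral>t. G t * p (u t) \<partial>lborel)"
      using Gp(2) by (simp add: abs_G)
    also have "\<dots> = (\<integral>t. G t * \<sigma> (u t) - G t * p (u t) \<partial>lborel)"
      using Gp(1) integrable_abs[OF Gi] by (subst Bochner_Integration.integral_diff) (simp_all add: abs_G)
    also have "\<dots> \<le> (\<integral>t. \<bar>G t\<bar> * \<bar>\<sigma> (u t) - p (u t)\<bar> \<partial>lborel)"
    proof (rule integral_mono)
      show "integrable lborel (\<lambda>t. G t * \<sigma> (u t) - G t * p (u t))"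
        using Gp(1) integrable_abs[OF Gi] by (intro Bochner_Integration.integrable_diff) (simp_all add: abs_G)
      show "integrable lborel (\<lambda>t. \<bar>G t\<bar> * \<bar>\<sigma> (u t) - p (u t)\<bar>)"
        using int_M(1)[of "\<lambda>y. \<bar>\<sigma> y - p y\<bar>"] \<sigma> p(2) by simp
      show "G t * \<sigma> (u t) - G t * p (u t) \<le> \<bar>G t\<bar> * \<bar>\<sigma> (u t) - p (u t)\<bar>" for t
        by (metis abs_ge_self abs_mult right_diff_distrib)
    qed
    also have "\<dots> = (\<integral>x. \<bar>\<sigma> x - p x\<bar> \<partial>M)" by (subst int_M(2)) auto
    finally show ?thesis using p(3) by simp
  qed
  then have "(\<integral>t. \<bar>G t\<bar> \<partial>lborel) \<le> 0" by (rule field_le_epsilon) simp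
  then have "(\<integral>t. \<bar>G t\<bar> \<partial>lborel) = 0" by (intro antisym) auto
  then have "AE t in lborel. \<bar>G t\<bar> = 0"
    using Gi by (subst (asm) integral_nonneg_eq_0_iff_AE) auto
  then show ?thesis by eventually_elim (simp add: G_def)
qed

lemma orthant_laplace_fun_diff:
  assumes "F \<in> orthant_laplace_fun" "G \<in> orthant_laplace_fun"
  shows "(\<lambda>t. F t - G t) \<in> orthant_laplace_fun"
  using assms unfolding orthant_laplace_fun_def
  by (auto simp: left_diff_distrib intro: borel_measurable_diff)

lemma laplace_unique:
  fixes f g :: "real ^ 'n::finite \<Rightarrow> real"
  assumes f: "f \<in> laplace_transformable" and g: "g \<in> laplace_transformable"
    and eq: "\<And>x. x \<in> pos_orthant \<Longrightarrow> laplace f x = laplace g x"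
  shows "ae_eq f g"
proof -
  obtain F where F: "F \<in> orthant_laplace_fun" "ae_eq f F" using f by (rule laplace_representative_exists)
  obtain G where G: "G \<in> orthant_laplace_fun" "ae_eq g G" using g by (rule laplace_representative_exists)
  have "AE t in lborel. F t - G t = 0"
  proof (rule laplace_unique_zero[OF orthant_laplace_fun_diff[OF F(1) G(1)]])
    fix x :: "real^'n" assume x: "x \<in> pos_orthant"
    show "(\<integral>t. (F t - G t) * exp (- (t \<bullet> x)) \<partial>lborel) = 0"
      using eq[OF x] x F(1) G(1) laplace_representative(2)[OF F] laplace_representative(2)[OF G]
      by (simp add: left_diff_distrib orthant_laplace_fun_def)
  qed
  with F(2) G(2) show ?thesis unfolding ae_eq_lborel by eventually_elim auto
qed

lemma laplace_cong:
  assumes f: "f \<in> laplace_transformable" and fg: "ae_eq f g"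
  shows "g \<in> laplace_transformable" and "laplace g x = laplace f x"
proof -
  obtain F where F: "F \<in> orthant_laplace_fun" "ae_eq f F" using f by (rule laplace_representative_exists)
  have "ae_eq g F" using fg F(2) ae_eq_sym ae_eq_trans by blast
  from laplace_representative[OF F(1) this] laplace_representative[OF F]
  show "g \<in> laplace_transformable" "laplace g x = laplace f x" by simp_all
qed

section \<open>Laplace transform of the Riemann-Liouville integral\<close>

lemma borel_measurable_shift_conv:
  fixes \<phi> :: "'b::euclidean_space \<Rightarrow> 'a::euclidean_space"
  assumes [measurable]: "k \<in> borel_measurable borel" "\<phi> \<in> borel_measurable borel" "F \<in> borel_measurable borel"
  shows "shift_conv k \<phi> F \<in> borel_measurable borel"
proof -
  have "(\<lambda>t. \<integral>s. k s * F (t - \<phi> s) \<partial>lborel) \<in> borel_measurable lborel"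
    by (rule lborel.borel_measurable_lebesgue_integral) measurable
  then show ?thesis by (simp add: shift_conv_def[abs_def])
qed

text \<open>The convolution theorem: after distributing the weight it is the product formula for
  total integrals. The hypothesis \<open>supp\<close> kills the integrand whenever \<open>t\<close>
  lies outside the orthant.\<close>

lemma shift_conv_orthant_laplace_fun:
  fixes \<phi> :: "'b::euclidean_space \<Rightarrow> real ^ 'n::finite"
  assumes F: "F \<in> orthant_laplace_fun"
    and k[measurable]: "k \<in> borel_measurable borel" and \<phi>[measurable]: "\<phi> \<in> borel_measurable borel"
    and supp: "\<And>s t. k s \<noteq> 0 \<Longrightarrow> t - \<phi> s \<in> pos_orthant \<Longrightarrow> t \<in> pos_orthant"
    and ki: "\<And>x. x \<in> pos_orthant \<Longrightarrow> integrable lborel (\<lambda>s. k s * exp (- (\<phi> s \<bullet> x)))"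
  shows "shift_conv k \<phi> F \<in> orthant_laplace_fun"
    and "x \<in> pos_orthant \<Longrightarrow> (\<integral>t. shift_conv k \<phi> F t * exp (- (t \<bullet> x)) \<partial>lborel) =
      (\<integral>s. k s * exp (- (\<phi> s \<bullet> x)) \<partial>lborel) * (\<integral>t. F t * exp (- (t \<bullet> x)) \<partial>lborel)"
proof -
  have Fm: "F \<in> borel_measurable borel"
    and F0: "\<And>t. t \<notin> pos_orthant \<Longrightarrow> F t = 0"
    and Fi: "\<And>x. x \<in> pos_orthant \<Longrightarrow> integrable lborel (\<lambda>t. F t * exp (- (t \<bullet> x)))"
    using F by (auto simp: orthant_laplace_fun_def)
  have "shift_conv k \<phi> F t = 0" if "t \<notin> pos_orthant" for t
  proof -
    have "k s * F (t - \<phi> s) = 0" for s using supp[of s t] F0[of "t - \<phi> s"] that by auto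
    then show ?thesis unfolding shift_conv_def by (simp only: integral_zero)
  qed
  moreover have "integrable lborel (\<lambda>t. shift_conv k \<phi> F t * exp (- (t \<bullet> x)))" if "x \<in> pos_orthant" for x
    unfolding shift_conv_exp_weight using integrable_shift_conv[OF ki[OF that] Fi[OF that] \<phi>] by simp
  ultimately show "shift_conv k \<phi> F \<in> orthant_laplace_fun"
    using borel_measurable_shift_conv[OF k \<phi> Fm] by (auto simp: orthant_laplace_fun_def)
  show "x \<in> pos_orthant \<Longrightarrow> (\<integral>t. shift_conv k \<phi> F t * exp (- (t \<bullet> x)) \<partial>lborel) =
      (\<integral>s. k s * exp (- (\<phi> s \<bullet> x)) \<partial>lborel) * (\<integral>t. F t * exp (- (t \<bullet> x)) \<partial>lborel)"
    unfolding shift_conv_exp_weight by (rule integral_shift_conv[OF ki Fi \<phi>])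
qed

text \<open>The causal power kernel whose convolution powers form the Riemann-Liouville semigroup;
  \<open>rl_kernel 1\<close> is the Heaviside function.\<close>

definition rl_kernel :: "real \<Rightarrow> real \<Rightarrow> real" where
  "rl_kernel a s = (if 0 < s then s powr (a - 1) / Gamma a else 0)"

lemma rl_kernel_measurable [measurable]: "rl_kernel a \<in> borel_measurable borel"
  unfolding rl_kernel_def[abs_def] by measurable

text \<open>Euler's integral for \<open>Gamma a\<close> after the substitution of
  \<open>x * s\<close> for the variable.\<close>

lemma rl_kernel_laplace:
  assumes a: "a > 0" and x: "x > 0"
  shows "has_bochner_integral lborel (\<lambda>s. rl_kernel a s * exp (- (s * x))) (x powr - a)"
proof -
  define g where "g t = indicator {0..} t * t powr (a - 1) / exp t" for t :: real
  have "has_bochner_integral lborel g (Gamma a)"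
  proof (rule has_bochner_integral_nn_integral)
    show "g \<in> borel_measurable lborel" unfolding g_def by measurable
    show "AE t in lborel. 0 \<le> g t" by (simp add: g_def)
    show "(\<integral>\<^sup>+t. ennreal (g t) \<partial>lborel) = ennreal (Gamma a)"
      using Gamma_conv_nn_integral_real[OF a] by (simp add: g_def)
    show "0 \<le> Gamma a" using a by (simp add: Gamma_real_nonneg)
  qed
  then have "has_bochner_integral lborel (\<lambda>s. g (0 + x * s)) (Gamma a /\<^sub>R \<bar>x\<bar>)"
    using x by (subst (asm) lborel_has_bochner_integral_real_affine_iff[of x _ _ 0]) auto
  then have "has_bochner_integral lborel (\<lambda>s. (x powr (1 - a) / Gamma a) * g (x * s))
      (x powr (1 - a) / Gamma a * (Gamma a / x))"
    using x by (intro has_bochner_integral_mult_right) (auto simp: field_simps)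
  moreover have "(x powr (1 - a) / Gamma a) * g (x * s) = rl_kernel a s * exp (- (s * x))" for s
  proof (cases "s > 0")
    case True
    then show ?thesis using x powr_add[of x "1 - a" "a - 1"]
      by (simp add: g_def rl_kernel_def powr_mult exp_minus field_simps)
  next
    \<comment> \<open>At \<open>s = 0\<close> both sides vanish because
      \<open>0 powr (a - 1)\<close> is \<open>0\<close> by convention.\<close>
    case False
    then show ?thesis using x by (cases "s = 0") (auto simp: g_def rl_kernel_def indicator_def zero_le_mult_iff)
  qed
  moreover have "x powr (1 - a) / Gamma a * (Gamma a / x) = x powr - a"
    using x Gamma_real_pos[OF a] powr_add[of x "-a" 1] by auto
  ultimately show ?thesis by simp
qed

lemma AE_lborel_reflect:
  fixes c :: real
  assumes "AE s in lborel. P s" shows "AE s in lborel. P (c - s)"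
proof -
  have "lborel = density (distr lborel borel (\<lambda>x. c + (-1) * x)) (\<lambda>_. ennreal \<bar>-1\<bar>)"
    by (rule lborel_real_affine) simp
  then have "distr lborel borel (\<lambda>s. c - s) = (lborel :: real measure)" by (simp add: density_1)
  with assms have "AE s in distr lborel borel (\<lambda>s. c - s). P s" by (simp only:)
  then show ?thesis by (rule AE_distrD[rotated]) simp
qed

text \<open>\<open>f\<close> and its Borel representative agree only up to a null set, and a single
  coordinate line may lie inside that set. For each fixed \<open>s\<close> the translated
  exceptional set is null; exchanging the quantifiers by Fubini shows that almost every line meets
  it in a null set.\<close>

lemma AE_translate_kernel:
  fixes \<phi> :: "'b::euclidean_space \<Rightarrow> 'a::euclidean_space"
  assumes \<phi>[measurable]: "\<phi> \<in> borel_measurable borel" and ae: "AE y in lborel. P y"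
  shows "AE t in lborel. AE s in lborel. P (t - \<phi> s)"
proof -
  have P: "pair_sigma_finite (lborel :: 'b measure) (lborel :: 'a measure)" ..
  \<comment> \<open>The exchange of quantifiers needs a measurable set in the product, hence the
    Borel null set around the exceptional points.\<close>
  from ae obtain N where N: "{y. \<not> P y} \<subseteq> N" "emeasure lborel N = 0" and [measurable]: "N \<in> sets borel"
    by (auto elim!: AE_E)
  have NAE: "AE y in lborel. y \<notin> N" using N by (intro AE_not_in) (auto intro: null_setsI)
  have "AE s in lborel. AE t in lborel. t - \<phi> s \<notin> N"
  proof (rule AE_I2)
    fix s
    have d: "distr lborel borel (\<lambda>t. t - \<phi> s) = (lborel :: 'a measure)"
      using lborel_distr_plus[of "- \<phi> s"] by (simp cong: distr_cong)
    have "AE t in distr lborel borel (\<lambda>t. t - \<phi> s). t \<notin> N" using NAE by (simp only: d)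
    then show "AE t in lborel. t - \<phi> s \<notin> N" by (rule AE_distrD[rotated]) simp
  qed
  moreover have "{x \<in> space (lborel \<Otimes>\<^sub>M lborel). snd x - \<phi> (fst x) \<notin> N} \<in> sets (lborel \<Otimes>\<^sub>M lborel)"
    by measurable
  ultimately have "AE t in lborel. AE s in lborel. t - \<phi> s \<notin> N"
    using pair_sigma_finite.AE_commute[OF P, of "\<lambda>s t. t - \<phi> s \<notin> N"] by (simp only:)
  then show ?thesis
    by eventually_elim (use N(1) in \<open>auto elim: eventually_mono\<close>)
qed

text \<open>The reflection of \<open>s\<close> to \<open>t $ i - s\<close> turns the one-dimensional
  integral into a shift along the axis. Its upper limit needs no mention on the right: beyond
  \<open>t $ i\<close> the shifted point leaves the orthant, where \<open>F\<close> is
  \<open>0\<close>.\<close>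

lemma RL_coord_shift_conv:
  fixes f :: "real ^ 'n::finite \<Rightarrow> real"
  assumes F: "F \<in> orthant_laplace_fun" and fF: "ae_eq f F" and a: "a > 0"
  shows "ae_eq (RL_coord i a f) (shift_conv (rl_kernel a) (\<lambda>s. s *\<^sub>R axis i 1) F)"
proof -
  have [measurable]: "F \<in> borel_measurable borel" using F by (simp add: orthant_laplace_fun_def)
  have "AE t in lborel. AE s in lborel. t - s *\<^sub>R axis i 1 \<in> pos_orthant \<longrightarrow>
      f (t - s *\<^sub>R axis i 1) = F (t - s *\<^sub>R axis i 1)"
    by (rule AE_translate_kernel[OF _ fF[unfolded ae_eq_lborel]]) measurable
  then show ?thesis unfolding ae_eq_lborel
  proof eventually_elim
    case (elim t)
    show ?case
    proof
      assume t: "t \<in> pos_orthant"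
      define upd where "upd s = (\<chi> j. if j = i then s else t $ j)" for s
      define g where "g s = indicator {0<..<t $ i} s * ((t $ i - s) powr (a - 1) * F (upd s))" for s
      have upd: "upd (t $ i - s) = t - s *\<^sub>R axis i 1" for s
        by (auto simp: upd_def vec_eq_iff axis_def)
      have upd': "upd s = t - (t $ i - s) *\<^sub>R axis i 1" for s using upd[of "t $ i - s"] by simp
      have [measurable]: "upd \<in> borel_measurable borel" unfolding upd'[abs_def] by measurable
      have gm: "g \<in> borel_measurable lborel" unfolding g_def by measurable
      have "AE s in lborel. upd s \<in> pos_orthant \<longrightarrow> f (upd s) = F (upd s)"
        using AE_lborel_reflect[OF elim, of "t $ i"] by (simp add: upd'[symmetric])
      then have "AE s in lborel. indicator {0<..<t $ i} s *\<^sub>R ((t $ i - s) powr (a - 1) * f (upd s)) = g s"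
      proof eventually_elim
        case (elim s)
        have "upd s \<in> pos_orthant" if "0 < s" using that t by (auto simp: upd_def pos_orthant_def)
        with elim show ?case by (auto simp: g_def indicator_def)
      qed
      note integral_lebesgue_cong(3)[OF gm this]
      then have "RL_coord i a f t = 1 / Gamma a * (\<integral>s. g s \<partial>lborel)"
        using a by (simp add: RL_coord_def set_lebesgue_integral_def upd_def)
      also have "(\<integral>s. g s \<partial>lborel) = (\<integral>s. g (t $ i - s) \<partial>lborel)"
        using lborel_integral_real_affine[of "-1" g "t $ i"] by simp
      also have "1 / Gamma a * \<dots> = (\<integral>s. 1 / Gamma a * g (t $ i - s) \<partial>lborel)" by simp
      also have "\<dots> = (\<integral>s. rl_kernel a s * F (t - s *\<^sub>R axis i 1) \<partial>lborel)"
      proof (rule Bochner_Integration.integral_cong)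
        fix s :: real
        have "F (t - s *\<^sub>R axis i 1) = 0" if "s \<ge> t $ i"
        proof -
          have "\<not> 0 < (t - s *\<^sub>R axis i 1) $ i" using that by simp
          then have "t - s *\<^sub>R axis i 1 \<notin> pos_orthant" unfolding pos_orthant_def mem_Collect_eq by blast
          then show ?thesis using F by (simp add: orthant_laplace_fun_def)
        qed
        then show "1 / Gamma a * g (t $ i - s) = rl_kernel a s * F (t - s *\<^sub>R axis i 1)"
          by (auto simp: g_def upd rl_kernel_def indicator_def not_less)
      qed simp
      finally show "RL_coord i a f t = shift_conv (rl_kernel a) (\<lambda>s. s *\<^sub>R axis i 1) F t"
        by (simp add: shift_conv_def)
    qed
  qed
qed

lemma RL_coord_laplace:
  fixes f :: "real ^ 'n::finite \<Rightarrow> real"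
  assumes f: "f \<in> laplace_transformable" and a: "a \<ge> 0"
  shows "RL_coord i a f \<in> laplace_transformable"
    and "x \<in> pos_orthant \<Longrightarrow> laplace (RL_coord i a f) x = x $ i powr - a * laplace f x"
proof -
  have "RL_coord i a f \<in> laplace_transformable \<and>
    (x \<in> pos_orthant \<longrightarrow> laplace (RL_coord i a f) x = x $ i powr - a * laplace f x)"
  proof (cases "a = 0")
    case True
    have "RL_coord i a f = f" using True by (simp add: fun_eq_iff RL_coord_def)
    have "x $ i \<noteq> 0" if "x \<in> pos_orthant"
    proof -
      have "0 < x $ i" using that by (simp add: pos_orthant_def)
      then show ?thesis by simp
    qed
    then have "x $ i powr - a = 1" if "x \<in> pos_orthant" using that True by simp
    with \<open>RL_coord i a f = f\<close> show ?thesis using f by (simp del: minus_zero)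
  next
    case False
    with a have a: "a > 0" by simp
    obtain F where F: "F \<in> orthant_laplace_fun" "ae_eq f F" using f by (rule laplace_representative_exists)
    let ?\<phi> = "\<lambda>s. s *\<^sub>R axis i 1 :: real ^ 'n"
    have k: "integrable lborel (\<lambda>s. rl_kernel a s * exp (- (?\<phi> s \<bullet> x)))"
      "(\<integral>s. rl_kernel a s * exp (- (?\<phi> s \<bullet> x)) \<partial>lborel) = x $ i powr - a" if "x \<in> pos_orthant" for x
      using rl_kernel_laplace[OF a, of "x $ i"] that
      by (auto simp: inner_axis' pos_orthant_def has_bochner_integral_iff)
    have supp: "t \<in> pos_orthant" if "rl_kernel a s \<noteq> 0" "t - ?\<phi> s \<in> pos_orthant" for s t
    proof -
      have "0 < s" using that(1) by (auto simp: rl_kernel_def split: if_splits)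
      then have "(t - ?\<phi> s) $ j \<le> t $ j" for j by (simp add: axis_def)
      then show ?thesis using that(2) unfolding pos_orthant_def mem_Collect_eq by (meson less_le_trans)
    qed
    have \<phi>: "?\<phi> \<in> borel_measurable borel" by measurable
    have H1: "shift_conv (rl_kernel a) ?\<phi> F \<in> orthant_laplace_fun"
      by (rule shift_conv_orthant_laplace_fun(1)[OF F(1) rl_kernel_measurable \<phi>]) (fact supp k(1))+
    have H2: "(\<integral>t. shift_conv (rl_kernel a) ?\<phi> F t * exp (- (t \<bullet> x)) \<partial>lborel) =
        (\<integral>s. rl_kernel a s * exp (- (?\<phi> s \<bullet> x)) \<partial>lborel) * (\<integral>t. F t * exp (- (t \<bullet> x)) \<partial>lborel)"
      if "x \<in> pos_orthant"
      by (rule shift_conv_orthant_laplace_fun(2)[OF F(1) rl_kernel_measurable \<phi>]) (fact supp k(1) that)+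
    note R = laplace_representative[OF H1 RL_coord_shift_conv[OF F a, of i]]
    have "laplace (RL_coord i a f) x = x $ i powr - a * laplace f x" if "x \<in> pos_orthant"
      unfolding R(2) H2[OF that] k(2)[OF that] laplace_representative(2)[OF F] ..
    with R(1) show ?thesis by blast
  qed
  then show "RL_coord i a f \<in> laplace_transformable"
    "x \<in> pos_orthant \<Longrightarrow> laplace (RL_coord i a f) x = x $ i powr - a * laplace f x" by auto
qed

text \<open>Each coordinate contributes a scalar factor. Scalars commute, so the order of
  composition disappears on the transform side.\<close>

lemma riemann_liouville_laplace:
  fixes f :: "(real, 'n::{finite, linorder}) vec \<Rightarrow> real"
  assumes f: "f \<in> laplace_transformable" and \<alpha>: "\<alpha> \<in> nonneg_orthant"
  shows "riemann_liouville \<alpha> f \<in> laplace_transformable"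
    and "x \<in> pos_orthant \<Longrightarrow> laplace (riemann_liouville \<alpha> f) x = (\<Prod>i\<in>UNIV. x $ i powr - (\<alpha> $ i)) * laplace f x"
proof -
  have *: "foldr (\<lambda>i. RL_coord i (\<alpha> $ i)) xs f \<in> laplace_transformable \<and> (x \<in> pos_orthant \<longrightarrow>
      laplace (foldr (\<lambda>i. RL_coord i (\<alpha> $ i)) xs f) x = (\<Prod>i\<leftarrow>xs. x $ i powr - (\<alpha> $ i)) * laplace f x)" for xs x
    using f \<alpha> by (induction xs) (auto simp: RL_coord_laplace nonneg_orthant_def)
  show "riemann_liouville \<alpha> f \<in> laplace_transformable"
    using * by (simp add: riemann_liouville_def)
  have "(\<Prod>i\<leftarrow>sorted_list_of_set UNIV. x $ i powr - (\<alpha> $ i)) = (\<Prod>i\<in>UNIV. x $ i powr - (\<alpha> $ i))"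
    using prod.distinct_set_conv_list[of "sorted_list_of_set (UNIV :: 'n set)" "\<lambda>i. x $ i powr - (\<alpha> $ i)"] by simp
  then show "x \<in> pos_orthant \<Longrightarrow> laplace (riemann_liouville \<alpha> f) x = (\<Prod>i\<in>UNIV. x $ i powr - (\<alpha> $ i)) * laplace f x"
    using * by (simp add: riemann_liouville_def)
qed

lemma axis_nonneg_orthant: "axis i 1 \<in> nonneg_orthant"
  by (simp add: nonneg_orthant_def axis_def)

lemma riemann_liouville_axis:
  "riemann_liouville (axis i 1) = RL_coord i 1"
proof -
  have z: "RL_coord j 0 = id" for j :: 'a by (simp add: fun_eq_iff RL_coord_def)
  have "foldr (\<lambda>j. RL_coord j (axis i 1 $ j)) xs = (if i \<in> set xs then RL_coord i 1 else id)" if "distinct xs" for xs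
    using that by (induction xs) (auto simp: z axis_def)
  then show ?thesis by (simp add: riemann_liouville_def)
qed

section \<open>Constants, monomials and convolution on boxes\<close>

text \<open>The orthant indicator is a product of Heaviside functions, so the integral factors into
  the one-dimensional transforms of \<open>rl_kernel 1\<close>. Positivity is what later allows
  division by the transform of \<open>1\<close>.\<close>

lemma orthant_indicator_laplace:
  fixes x :: "real ^ 'n::finite"
  assumes x: "x \<in> pos_orthant"
  shows "integrable lborel (\<lambda>t. indicator pos_orthant t * exp (- (t \<bullet> x)))"
    and "(\<integral>t. indicator pos_orthant t * exp (- (t \<bullet> x)) \<partial>lborel) > 0"
proof -
  have xb: "x \<bullet> b > 0" if "b \<in> Basis" for b
    using x that by (auto simp: Basis_vec_def inner_axis pos_orthant_def)
  have prod: "indicator pos_orthant t * exp (- (t \<bullet> x)) = (\<Prod>b\<in>Basis. rl_kernel 1 (t \<bullet> b) * exp (- ((t \<bullet> b) * (x \<bullet> b))))" for t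
  proof -
    have "(\<Prod>b\<in>Basis. rl_kernel 1 (t \<bullet> b)) = (\<Prod>b\<in>Basis. if 0 < t \<bullet> b then 1 else 0)"
      by (intro prod.cong) (auto simp: rl_kernel_def)
    also have "\<dots> = indicator pos_orthant t"
    proof (cases "t \<in> pos_orthant")
      case True
      then show ?thesis
        by (simp, intro prod.neutral) (auto simp: pos_orthant_def Basis_vec_def inner_axis)
    next
      case False
      then obtain i where "\<not> 0 < t \<bullet> axis i 1" by (auto simp: pos_orthant_def inner_axis)
      moreover have "axis i (1::real) \<in> Basis" by (auto simp: Basis_vec_def)
      ultimately show ?thesis using False by (auto simp: prod_zero_iff)
    qed
    finally show ?thesis
      by (simp add: prod.distrib euclidean_inner[of t x] sum_negf[symmetric] exp_sum)
  qed
  have nn: "(\<integral>\<^sup>+t. ennreal (indicator pos_orthant t * exp (- (t \<bullet> x))) \<partial>lborel) = ennreal (\<Prod>b\<in>Basis. (x \<bullet> b) powr - 1)"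
  proof -
    have nonneg: "rl_kernel 1 s * exp (- (s * c)) \<ge> 0" for s c by (simp add: rl_kernel_def)
    have "(\<integral>\<^sup>+t. ennreal (indicator pos_orthant t * exp (- (t \<bullet> x))) \<partial>lborel) =
        (\<integral>\<^sup>+t. (\<Prod>b\<in>Basis. ennreal (rl_kernel 1 (t \<bullet> b) * exp (- ((t \<bullet> b) * (x \<bullet> b))))) \<partial>lborel)"
      unfolding prod by (simp only: prod_ennreal nonneg)
    also have "\<dots> = (\<Prod>b\<in>Basis. \<integral>\<^sup>+s. ennreal (rl_kernel 1 s * exp (- (s * (x \<bullet> b)))) \<partial>lborel)"
      by (rule nn_integral_lborel_prod) auto
    also have "\<dots> = (\<Prod>b\<in>Basis. ennreal ((x \<bullet> b) powr - 1))"
    proof (intro prod.cong refl)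
      fix b :: "real ^ 'n" assume "b \<in> Basis"
      from rl_kernel_laplace[OF _ xb[OF this], of 1]
      show "(\<integral>\<^sup>+s. ennreal (rl_kernel 1 s * exp (- (s * (x \<bullet> b)))) \<partial>lborel) = ennreal ((x \<bullet> b) powr - 1)"
        using nonneg by (simp add: nn_integral_eq_integral has_bochner_integral_iff)
    qed
    finally show ?thesis by (simp add: prod_ennreal)
  qed
  have "has_bochner_integral lborel (\<lambda>t. indicator pos_orthant t * exp (- (t \<bullet> x))) (\<Prod>b\<in>Basis. (x \<bullet> b) powr - 1)"
    by (rule has_bochner_integral_nn_integral[OF _ _ _ nn]) (auto intro: prod_nonneg)
  moreover have "(\<Prod>b\<in>Basis. (x \<bullet> b) powr - 1) > 0" using xb by (intro prod_pos) (force simp: less_imp_neq)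
  ultimately show "integrable lborel (\<lambda>t. indicator pos_orthant t * exp (- (t \<bullet> x)))"
    "(\<integral>t. indicator pos_orthant t * exp (- (t \<bullet> x)) \<partial>lborel) > 0" by (auto simp: has_bochner_integral_iff)
qed

lemma orthant_indicator: "indicator pos_orthant \<in> orthant_laplace_fun"
  using orthant_indicator_laplace(1) by (auto simp: orthant_laplace_fun_def)

lemma laplace_const_one:
  fixes x :: "real ^ 'n::finite"
  shows "(\<lambda>_ :: real ^ 'n. 1) \<in> laplace_transformable"
    and "x \<in> pos_orthant \<Longrightarrow> laplace (\<lambda>_. 1) x > 0"
proof -
  have "ae_eq (\<lambda>_ :: real ^ 'n. 1) (indicator pos_orthant)" by (simp add: ae_eq_lborel)
  from laplace_representative[OF orthant_indicator this]
  show "(\<lambda>_ :: real ^ 'n. 1) \<in> laplace_transformable" "x \<in> pos_orthant \<Longrightarrow> laplace (\<lambda>_. 1) x > 0"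
    by (simp_all add: orthant_indicator_laplace(2))
qed

lemma laplace_transformable_add:
  "f \<in> laplace_transformable \<Longrightarrow> g \<in> laplace_transformable \<Longrightarrow> (\<lambda>t. f t + g t) \<in> laplace_transformable"
  by (simp add: laplace_transformable_def distrib_right set_integral_add)

lemma laplace_add:
  "f \<in> laplace_transformable \<Longrightarrow> g \<in> laplace_transformable \<Longrightarrow> x \<in> pos_orthant \<Longrightarrow>
    laplace (\<lambda>t. f t + g t) x = laplace f x + laplace g x"
  by (simp add: laplace_transformable_def laplace_def distrib_right set_integral_add)

lemma laplace_transformable_scale:
  "f \<in> laplace_transformable \<Longrightarrow> (\<lambda>t. c * f t) \<in> laplace_transformable"
  by (simp add: laplace_transformable_def mult.assoc)

lemma laplace_scale: "laplace (\<lambda>t. c * f t) x = c * laplace f x"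
  by (simp add: laplace_def mult.assoc)

lemma integral_power_open_interval:
  assumes "0 < (c::real)"
  shows "(LINT s:{0<..<c}|lebesgue. s ^ m * d) = c ^ Suc m / Suc m * d"
proof -
  have "AE s in lborel. s \<noteq> 0 \<and> s \<noteq> c" by (simp add: AE_lborel_singleton)
  then have "AE s in lborel. indicator {0<..<c} s *\<^sub>R (s ^ m * d) = s ^ m * indicator {0..c} s * d"
    by eventually_elim (auto simp: indicator_def)
  from integral_lebesgue_cong(3)[OF _ this]
  have "(LINT s:{0<..<c}|lebesgue. s ^ m * d) = (\<integral>s. s ^ m * indicator {0..c} s * d \<partial>lborel)"
    unfolding set_lebesgue_integral_def by measurable
  also have "\<dots> = c ^ Suc m / Suc m * d"
    using assms integral_power[of 0 c m] by simp
  finally show ?thesis .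
qed

lemma RL_coord_monomial:
  fixes i :: "'n::finite"
  assumes t: "t \<in> pos_orthant"
  shows "RL_coord i 1 (monomial_fun k) t = monomial_fun (k(i := Suc (k i))) t / Suc (k i)"
proof -
  have ti: "0 < t $ i" using t by (simp add: pos_orthant_def)
  define C where "C = (\<Prod>j\<in>UNIV - {i}. t $ j ^ k j)"
  have C: "monomial_fun k (\<chi> j. if j = i then s else t $ j) = s ^ k i * C" for s
  proof -
    have "monomial_fun k (\<chi> j. if j = i then s else t $ j) =
        s ^ k i * (\<Prod>j\<in>UNIV - {i}. (if j = i then s else t $ j) ^ k j)"
      unfolding monomial_fun_def by (subst prod.remove[of _ i]) auto
    also have "(\<Prod>j\<in>UNIV - {i}. (if j = i then s else t $ j) ^ k j) = C"
      unfolding C_def by (intro prod.cong) auto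
    finally show ?thesis .
  qed
  \<comment> \<open>The weight is \<open>1\<close> here because \<open>t $ i - s\<close> is nonzero
    on the open interval, whereas \<open>0 powr 0\<close> would be \<open>0\<close>.\<close>
  have "(LINT s:{0<..<t $ i}|lebesgue. (t $ i - s) powr (1 - 1) * monomial_fun k (\<chi> j. if j = i then s else t $ j)) =
      (LINT s:{0<..<t $ i}|lebesgue. s ^ k i * C)"
    by (intro set_lebesgue_integral_cong) (auto simp: C)
  also have "\<dots> = t $ i ^ Suc (k i) / Suc (k i) * C" by (rule integral_power_open_interval[OF ti])
  also have "t $ i ^ Suc (k i) / Suc (k i) * C = t $ i * (t $ i ^ k i * C) / Suc (k i)" by simp
  also have "t $ i ^ k i * C = monomial_fun k t"
    unfolding C_def monomial_fun_def by (subst (2) prod.remove[of _ i]) auto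
  also have "t $ i * \<dots> = monomial_fun (k(i := Suc (k i))) t" by (rule monomial_fun_mult)
  finally show ?thesis unfolding RL_coord_def by simp
qed

section \<open>Mean convergence on boxes\<close>

lemma box_subset_pos_orthant: "box 0 T \<subseteq> (pos_orthant :: (real ^ 'n::finite) set)"
  by (auto simp: pos_orthant_def mem_box_cart)

text \<open>On a bounded box the exponential weight is bounded below, so weighted integrability
  gives integrability.\<close>

lemma integrable_on_box:
  assumes F: "F \<in> orthant_laplace_fun"
  shows "integrable lborel (\<lambda>t. indicator (box 0 T) t * F t)"
proof -
  define x :: "real ^ 'a" where "x = (\<chi> i. 1)"
  have "integrable lborel (\<lambda>t. F t * exp (- (t \<bullet> x)))" and [measurable]: "F \<in> borel_measurable borel"
    using F by (auto simp: orthant_laplace_fun_def x_def pos_orthant_def)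
  then have "integrable lborel (\<lambda>t. exp (T \<bullet> x) * (F t * exp (- (t \<bullet> x))))" by simp
  then show ?thesis
  proof (rule Bochner_Integration.integrable_bound)
    show "AE t in lborel. norm (indicator (box 0 T) t * F t) \<le> norm (exp (T \<bullet> x) * (F t * exp (- (t \<bullet> x))))"
    proof (rule AE_I2)
      fix t
      show "norm (indicator (box 0 T) t * F t) \<le> norm (exp (T \<bullet> x) * (F t * exp (- (t \<bullet> x))))"
      proof (cases "t \<in> box 0 T")
        case True
        then have "t \<bullet> x \<le> T \<bullet> x" by (simp add: inner_vec_def x_def) (intro sum_mono, simp add: mem_box_cart less_imp_le)
        then have "1 \<le> exp (T \<bullet> x) * exp (- (t \<bullet> x))" by (simp add: exp_add[symmetric])
        then have "\<bar>F t\<bar> * 1 \<le> \<bar>F t\<bar> * (exp (T \<bullet> x) * exp (- (t \<bullet> x)))" by (intro mult_left_mono) auto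
        then show ?thesis using True by (simp add: abs_mult mult_ac)
      qed simp
    qed
  qed measurable
qed

lemma L1_norm_representative:
  assumes F: "F \<in> orthant_laplace_fun" and fF: "ae_eq f F"
  shows "L1_norm T f = (\<integral>t. indicator (box 0 T) t * \<bar>F t\<bar> \<partial>lborel)"
proof -
  have [measurable]: "F \<in> borel_measurable borel" using F by (simp add: orthant_laplace_fun_def)
  have "AE t in lborel. indicator (box 0 T) t *\<^sub>R \<bar>f t\<bar> = indicator (box 0 T) t * \<bar>F t\<bar>"
    using fF[unfolded ae_eq_lborel] by eventually_elim (use box_subset_pos_orthant[of T] in \<open>auto simp: indicator_def\<close>)
  from integral_lebesgue_cong(3)[OF _ this] show ?thesis
    by (simp add: L1_norm_def set_lebesgue_integral_def)
qed

lemma AE_zero_on_boxes: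
  fixes F :: "real ^ 'n::finite \<Rightarrow> real"
  assumes F: "F \<in> orthant_laplace_fun"
    and small: "\<And>T. T \<in> pos_orthant \<Longrightarrow> (\<integral>t. indicator (box 0 T) t * \<bar>F t\<bar> \<partial>lborel) = 0"
  shows "AE t in lborel. F t = 0"
proof -
  have [measurable]: "F \<in> borel_measurable borel" using F by (simp add: orthant_laplace_fun_def)
  \<comment> \<open>Countably many boxes exhaust the orthant; \<open>Suc\<close> makes every corner,
    the one for \<open>N = 0\<close> included, a point of the open orthant.\<close>
  define T :: "nat \<Rightarrow> real ^ 'n" where "T N = (\<chi> i. real (Suc N))" for N
  have "AE t in lborel. t \<in> box 0 (T N) \<longrightarrow> F t = 0" for N
  proof -
    have "integrable lborel (\<lambda>t. indicator (box 0 (T N)) t * \<bar>F t\<bar>)"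
      using integrable_abs[OF integrable_on_box[OF F, of "T N"]] by (simp add: abs_mult)
    moreover have "(\<integral>t. indicator (box 0 (T N)) t * \<bar>F t\<bar> \<partial>lborel) = 0"
      by (rule small) (simp add: T_def pos_orthant_def)
    ultimately have "AE t in lborel. indicator (box 0 (T N)) t * \<bar>F t\<bar> = 0"
      by (subst (asm) integral_nonneg_eq_0_iff_AE) auto
    then show ?thesis by eventually_elim (auto simp: indicator_def)
  qed
  then have "AE t in lborel. \<forall>N. t \<in> box 0 (T N) \<longrightarrow> F t = 0" by (intro AE_all_countable[THEN iffD2] allI)
  then show ?thesis
  proof eventually_elim
    case (elim t)
    show "F t = 0"
    proof (cases "t \<in> pos_orthant")
      case True
      obtain N where N: "norm t < real N" using reals_Archimedean2 by blast
      have "t $ i < real (Suc N)" for i using component_le_norm_cart[of t i] N by simp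
      then have "t \<in> box 0 (T N)" using True by (auto simp: T_def mem_box_cart pos_orthant_def)
      with elim show ?thesis by blast
    qed (use F in \<open>simp add: orthant_laplace_fun_def\<close>)
  qed
qed

section \<open>Convolution on the orthant\<close>

abbreviation conv :: "(real ^ 'n::finite \<Rightarrow> real) \<Rightarrow> (real ^ 'n \<Rightarrow> real) \<Rightarrow> real ^ 'n \<Rightarrow> real" where
  "conv k F \<equiv> shift_conv k (\<lambda>s. s) F"

lemma conv_orthant_laplace_fun:
  assumes k: "k \<in> orthant_laplace_fun" and F: "F \<in> orthant_laplace_fun"
  shows "conv k F \<in> orthant_laplace_fun"
    and "x \<in> pos_orthant \<Longrightarrow> (\<integral>t. conv k F t * exp (- (t \<bullet> x)) \<partial>lborel) =
      (\<integral>s. k s * exp (- (s \<bullet> x)) \<partial>lborel) * (\<integral>t. F t * exp (- (t \<bullet> x)) \<partial>lborel)"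
proof -
  have km: "k \<in> borel_measurable borel" and m: "(\<lambda>s. s :: real ^ 'a) \<in> borel_measurable borel"
    and ki: "\<And>x. x \<in> pos_orthant \<Longrightarrow> integrable lborel (\<lambda>s. k s * exp (- (s \<bullet> x)))"
    using k by (auto simp: orthant_laplace_fun_def)
  have supp: "t \<in> pos_orthant" if "k s \<noteq> 0" "t - s \<in> pos_orthant" for s t
  proof -
    have "s \<in> pos_orthant" using k that(1) by (auto simp: orthant_laplace_fun_def)
    then show ?thesis using that(2) unfolding pos_orthant_def
      by (auto simp: less_diff_eq intro: add_pos_pos less_trans)
  qed
  show "conv k F \<in> orthant_laplace_fun"
    by (rule shift_conv_orthant_laplace_fun(1)[OF F km m]) (fact supp ki)+
  show "(\<integral>t. conv k F t * exp (- (t \<bullet> x)) \<partial>lborel) =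
      (\<integral>s. k s * exp (- (s \<bullet> x)) \<partial>lborel) * (\<integral>t. F t * exp (- (t \<bullet> x)) \<partial>lborel)"
    if "x \<in> pos_orthant"
    by (rule shift_conv_orthant_laplace_fun(2)[OF F km m]) (fact supp ki that)+
qed

text \<open>The weighted factors are integrable, so their convolution integral exists almost
  everywhere; removing the weight costs the factor \<open>exp (t \<bullet> x)\<close>, constant in
  \<open>s\<close>.\<close>

lemma AE_integrable_conv:
  assumes k: "k \<in> orthant_laplace_fun" and F: "F \<in> orthant_laplace_fun"
  shows "AE t in lborel. integrable lborel (\<lambda>s. k s * F (t - s))"
proof -
  define x :: "real ^ 'a" where "x = (\<chi> i. 1)"
  have x: "x \<in> pos_orthant" by (simp add: x_def pos_orthant_def)
  have "AE t in lborel. integrable lborel (\<lambda>s. (k s * exp (- (s \<bullet> x))) * (F (t - s) * exp (- ((t - s) \<bullet> x))))"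
    using k F x by (intro AE_integrable_shift_conv[where \<phi> = "\<lambda>s. s" and F = "\<lambda>t. F t * exp (- (t \<bullet> x))"])
      (auto simp: orthant_laplace_fun_def)
  then show ?thesis
  proof eventually_elim
    case (elim t)
    have "exp (t \<bullet> x) * ((k s * exp (- (s \<bullet> x))) * (F (t - s) * exp (- ((t - s) \<bullet> x)))) = k s * F (t - s)" for s
      by (simp add: inner_diff_left exp_diff exp_minus field_simps)
    with integrable_mult_right[OF elim, of "exp (t \<bullet> x)"] show ?case by simp
  qed
qed

text \<open>Only almost everywhere: where an integral fails to exist it has the default value
  \<open>0\<close>, and linearity may break.\<close>

lemma conv_diff:
  assumes "k \<in> orthant_laplace_fun" "F \<in> orthant_laplace_fun" "G \<in> orthant_laplace_fun"
  shows "AE t in lborel. conv k (\<lambda>t. F t - G t) t = conv k F t - conv k G t"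
  using AE_integrable_conv[OF assms(1,2)] AE_integrable_conv[OF assms(1,3)]
  by eventually_elim (simp add: shift_conv_def right_diff_distrib)

text \<open>Causality: if \<open>s\<close> and \<open>t - s\<close> lie in the orthant and
  \<open>t\<close> in the box, then both lie in the box. Both factors may be truncated to the box,
  and the product formula for total integrals gives a local Young inequality.\<close>

lemma conv_box_bound:
  assumes k: "k \<in> orthant_laplace_fun" and F: "F \<in> orthant_laplace_fun"
  shows "(\<integral>t. indicator (box 0 T) t * \<bar>conv k F t\<bar> \<partial>lborel) \<le>
    (\<integral>s. indicator (box 0 T) s * \<bar>k s\<bar> \<partial>lborel) * (\<integral>t. indicator (box 0 T) t * \<bar>F t\<bar> \<partial>lborel)"
proof -
  let ?k = "\<lambda>s. indicator (box 0 T) s * \<bar>k s\<bar>" and ?F = "\<lambda>s. indicator (box 0 T) s * \<bar>F s\<bar>"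
  have abs_int: "integrable lborel (\<lambda>s. indicator (box 0 T) s * \<bar>G s\<bar>)" if "G \<in> orthant_laplace_fun" for G
    using integrable_abs[OF integrable_on_box[OF that, of T]] by (simp add: abs_mult)
  note i = abs_int[OF k] abs_int[OF F]
  have "(\<integral>t. indicator (box 0 T) t * \<bar>conv k F t\<bar> \<partial>lborel) \<le> (\<integral>t. conv ?k ?F t \<partial>lborel)"
  proof (rule integral_mono)
    show "integrable lborel (\<lambda>t. indicator (box 0 T) t * \<bar>conv k F t\<bar>)"
      by (rule abs_int[OF conv_orthant_laplace_fun(1)[OF k F]])
    show "integrable lborel (conv ?k ?F)" using i by (intro integrable_shift_conv) auto
    fix t
    show "indicator (box 0 T) t * \<bar>conv k F t\<bar> \<le> conv ?k ?F t"
    proof (cases "t \<in> box 0 T")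
      case True
      have "\<bar>k s * F (t - s)\<bar> = ?k s * ?F (t - s)" for s
      proof (cases "k s = 0 \<or> F (t - s) = 0")
        case False
        then have "s \<in> pos_orthant" "t - s \<in> pos_orthant" using k F by (auto simp: orthant_laplace_fun_def)
        then have p: "0 < s $ i" "s $ i < t $ i" for i by (auto simp: pos_orthant_def)
        have "t $ i < T $ i" for i using True by (simp add: mem_box_cart)
        then have "s \<in> box 0 T" "t - s \<in> box 0 T"
          using p by (auto simp: mem_box_cart intro: less_trans) (smt (verit) p)
        then show ?thesis by (simp add: abs_mult)
      qed auto
      then have "conv ?k ?F t = (\<integral>s. \<bar>k s * F (t - s)\<bar> \<partial>lborel)" by (simp add: shift_conv_def)
      moreover have "\<bar>conv k F t\<bar> \<le> (\<integral>s. \<bar>k s * F (t - s)\<bar> \<partial>lborel)"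
        unfolding shift_conv_def by (rule integral_abs_bound)
      ultimately show ?thesis using True by simp
    next
      case False
      have "0 \<le> conv ?k ?F t" unfolding shift_conv_def by (intro integral_nonneg_AE) auto
      with False show ?thesis by simp
    qed
  qed
  also have "\<dots> = (\<integral>s. ?k s \<partial>lborel) * (\<integral>t. ?F t \<partial>lborel)" using i by (intro integral_shift_conv) auto
  finally show ?thesis .
qed

lemma polynomial_dense_on_box:
  fixes F :: "real ^ 'n::finite \<Rightarrow> real"
  assumes F: "F \<in> orthant_laplace_fun" and "\<epsilon> > 0"
  shows "\<exists>p. monomial_span p \<and> (\<integral>t. indicator (box 0 T) t * \<bar>F t - p t\<bar> \<partial>lborel) < \<epsilon>"
proof -
  have [measurable]: "F \<in> borel_measurable borel" using F by (simp add: orthant_laplace_fun_def)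
  define M where "M = density lborel (indicator (box 0 T) :: real ^ 'n \<Rightarrow> ennreal)"
  have "finite_measure M"
  proof
    have "emeasure M (space M) = emeasure lborel (box 0 T)"
      by (simp add: M_def emeasure_density)
    then show "emeasure M (space M) \<noteq> \<infinity>" using emeasure_lborel_box_finite[of 0 T] by (simp add: less_top[symmetric])
  qed
  have sM: "sets M = sets borel" by (simp add: M_def)
  have ind: "M = density lborel (\<lambda>t. ennreal (indicator (box 0 T) t))"
    by (simp add: M_def ennreal_indicator)
  have AEK: "AE t in M. t \<in> cbox 0 T"
    unfolding M_def using box_subset_cbox[of 0 T] by (subst AE_density) (auto simp: indicator_def)
  have "integrable M F" unfolding ind using integrable_on_box[OF F, of T] by (subst integrable_density) auto
  from polynomial_dense_L1[OF \<open>finite_measure M\<close> sM compact_cbox AEK this \<open>\<epsilon> > 0\<close>] obtain p where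
    p: "real_polynomial_function p" "(\<integral>t. \<bar>F t - p t\<bar> \<partial>M) < \<epsilon>" by blast
  have [measurable]: "p \<in> borel_measurable borel"
    using p(1) by (intro borel_measurable_continuous_onI)
      (simp add: continuous_on_polymonial_function real_polynomial_function_eq)
  have "(\<integral>t. \<bar>F t - p t\<bar> \<partial>M) = (\<integral>t. indicator (box 0 T) t * \<bar>F t - p t\<bar> \<partial>lborel)"
    unfolding ind by (subst integral_density) auto
  with p real_polynomial_function_monomial_span[OF p(1)] show ?thesis by auto
qed

section \<open>The multiplier of a fractional family\<close>

text \<open>\<open>\<eta> c\<close> is nonzero because it divides a power of
  \<open>\<eta> 1\<close>, and it is a square, that of \<open>\<eta> (c / 2)\<close>. No continuity
  is involved.\<close>

lemma multiplicative_pos: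
  fixes \<eta> :: "real \<Rightarrow> real"
  assumes mult: "\<And>a b. a \<ge> 0 \<Longrightarrow> b \<ge> 0 \<Longrightarrow> \<eta> (a + b) = \<eta> a * \<eta> b"
    and one: "\<eta> 1 > 0" and c: "c \<ge> 0"
  shows "\<eta> c > 0"
proof -
  have zero: "\<eta> 0 = 1" using mult[of 1 0] one by simp
  have pow: "\<eta> (real n) = \<eta> 1 ^ n" for n
    by (induction n) (simp_all add: zero mult)
  obtain n :: nat where "c \<le> real n" using real_arch_simple by blast
  then have "\<eta> c * \<eta> (real n - c) = \<eta> 1 ^ n" using mult[of c "real n - c"] c pow[of n] by simp
  then have "\<eta> c \<noteq> 0" using one by auto
  moreover have "\<eta> c = \<eta> (c / 2) * \<eta> (c / 2)" using mult[of "c / 2" "c / 2"] c by simp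
  ultimately show ?thesis by (metis mult_eq_0_iff not_real_square_gt_zero)
qed

text \<open>After taking logarithms and subtracting the linear solution, an additive function
  remains that vanishes at the nonnegative rationals and tends to \<open>0\<close> at
  \<open>0\<close> from the right.\<close>

lemma multiplicative_powr:
  fixes \<eta> :: "real \<Rightarrow> real"
  assumes mult: "\<And>a b. a \<ge> 0 \<Longrightarrow> b \<ge> 0 \<Longrightarrow> \<eta> (a + b) = \<eta> a * \<eta> b"
    and one: "\<eta> 1 > 0" and lim: "(\<eta> \<longlongrightarrow> 1) (at_right 0)" and c: "c \<ge> 0"
  shows "\<eta> c = \<eta> 1 powr c"
proof -
  have pos: "\<eta> a > 0" if "a \<ge> 0" for a using multiplicative_pos[OF mult one that] .
  define \<psi> where "\<psi> a = ln (\<eta> a) - a * ln (\<eta> 1)" for a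
  have add: "\<psi> (a + b) = \<psi> a + \<psi> b" if "a \<ge> 0" "b \<ge> 0" for a b
    using that pos[OF that(1)] pos[OF that(2)] by (simp add: \<psi>_def mult ln_mult algebra_simps)
  have \<psi>0: "\<psi> 0 = 0" using add[of 0 0] by simp
  have nat_mult: "\<psi> (real n * a) = real n * \<psi> a" if "a \<ge> 0" for n a
    using that by (induction n) (simp_all add: \<psi>0 distrib_right add)
  have rat: "\<psi> q = 0" if qQ: "q \<in> \<rat>" and q0: "q \<ge> 0" for q
  proof -
    obtain m n :: nat where n: "n \<noteq> 0" and q: "q = real m / real n"
      using Rats_abs_nat_div_natE[OF qQ] q0 by (metis abs_of_nonneg)
    have nq: "real n * q = real m * 1" using n by (simp add: q)
    have "real n * \<psi> q = \<psi> (real m * 1)" unfolding nq[symmetric] by (rule nat_mult[OF q0, symmetric])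
    also have "\<dots> = 0" by (subst nat_mult) (simp_all add: \<psi>_def)
    finally show ?thesis using n by simp
  qed
  have "(\<psi> \<longlongrightarrow> ln 1 - 0 * ln (\<eta> 1)) (at_right 0)"
    unfolding \<psi>_def by (intro tendsto_intros lim) auto
  then have \<psi>lim: "(\<psi> \<longlongrightarrow> 0) (at_right 0)" by simp
  have "\<psi> c = 0"
  proof (cases "c = 0")
    case False
    with c have c: "c > 0" by simp
    have "\<bar>\<psi> c\<bar> \<le> \<epsilon>" if "\<epsilon> > 0" for \<epsilon>
    proof -
      have "eventually (\<lambda>s. \<bar>\<psi> s\<bar> < \<epsilon>) (at_right 0)"
        using tendstoD[OF \<psi>lim that] by simp
      then obtain d where d: "d > 0" "\<And>s. 0 < s \<Longrightarrow> s < d \<Longrightarrow> \<bar>\<psi> s\<bar> < \<epsilon>"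
        by (auto simp: eventually_at_right_field)
      \<comment> \<open>A rational just below \<open>c\<close>: the maximum keeps \<open>q\<close>
        positive and \<open>c - q\<close> within the range where \<open>\<psi>\<close> is
        small.\<close>
      obtain q where q: "q \<in> \<rat>" "max 0 (c - d) < q" "q < c"
        using Rats_dense_in_real[of "max 0 (c - d)" c] c d(1) by auto
      have "\<psi> c = \<psi> q + \<psi> (c - q)" using add[of q "c - q"] q by simp
      then show ?thesis using rat[of q] q d(2)[of "c - q"] by simp
    qed
    then have "\<bar>\<psi> c\<bar> \<le> 0" by (rule field_le_epsilon) simp
    then show ?thesis by simp
  qed (simp add: \<psi>0)
  then have "ln (\<eta> c) = c * ln (\<eta> 1)" by (simp add: \<psi>_def)
  then show ?thesis using pos[OF c] one by (metis exp_ln less_irrefl powr_def)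
qed

text \<open>Continuity in the order is kept out of the locale: it enters \<open>J_factor_eq\<close>
  at one fixed \<open>x\<close>, since its point may change with \<open>x\<close>.\<close>

locale fractional_family =
  fixes J :: "(real, 'n::{finite, linorder}) vec \<Rightarrow> ((real, 'n) vec \<Rightarrow> real) \<Rightarrow> ((real, 'n) vec \<Rightarrow> real)"
  assumes maps_to: "\<And>\<alpha> f. \<lbrakk>\<alpha> \<in> nonneg_orthant; f \<in> laplace_transformable\<rbrakk>
          \<Longrightarrow> J \<alpha> f \<in> laplace_transformable"
    and additive: "\<And>\<alpha> f g. \<lbrakk>\<alpha> \<in> nonneg_orthant; f \<in> laplace_transformable; g \<in> laplace_transformable\<rbrakk>
          \<Longrightarrow> ae_eq (J \<alpha> (\<lambda>t. f t + g t)) (\<lambda>t. J \<alpha> f t + J \<alpha> g t)"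
    and homogeneous: "\<And>\<alpha> f c. \<lbrakk>\<alpha> \<in> nonneg_orthant; f \<in> laplace_transformable\<rbrakk>
          \<Longrightarrow> ae_eq (J \<alpha> (\<lambda>t. c * f t)) (\<lambda>t. c * J \<alpha> f t)"
    and L1_continuous: "\<And>\<alpha> T \<epsilon>. \<lbrakk>\<alpha> \<in> nonneg_orthant; T \<in> pos_orthant; \<epsilon> > 0\<rbrakk>
          \<Longrightarrow> \<exists>\<delta>>0. \<forall>f1\<in>laplace_transformable. \<forall>f2\<in>laplace_transformable.
                L1_norm T (\<lambda>t. f1 t - f2 t) < \<delta> \<longrightarrow> L1_norm T (\<lambda>t. J \<alpha> f1 t - J \<alpha> f2 t) < \<epsilon>"
    and identity: "\<And>i f. f \<in> laplace_transformable
          \<Longrightarrow> ae_eq (J (axis i 1) f) (riemann_liouville (axis i 1) f)"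
    and index_law: "\<And>\<alpha> \<beta> f. \<lbrakk>\<alpha> \<in> nonneg_orthant; \<beta> \<in> nonneg_orthant; f \<in> laplace_transformable\<rbrakk>
          \<Longrightarrow> ae_eq (J (\<alpha> + \<beta>) f) (J \<alpha> (J \<beta> f))"
begin

text \<open>\<open>J \<alpha>\<close> acts on functions, not on classes. That it respects a.e.
  equality comes from continuity: the mean distance of \<open>f\<close> and \<open>g\<close> is
  \<open>0\<close> on every box, below any \<open>\<delta>\<close>.\<close>

lemma J_cong:
  assumes \<alpha>: "\<alpha> \<in> nonneg_orthant" and f: "f \<in> laplace_transformable" and fg: "ae_eq f g"
  shows "ae_eq (J \<alpha> f) (J \<alpha> g)"
proof -
  have g: "g \<in> laplace_transformable" using laplace_cong[OF f fg] by simp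
  obtain F where F: "F \<in> orthant_laplace_fun" "ae_eq (J \<alpha> f) F"
    using maps_to[OF \<alpha> f] by (rule laplace_representative_exists)
  obtain G where G: "G \<in> orthant_laplace_fun" "ae_eq (J \<alpha> g) G"
    using maps_to[OF \<alpha> g] by (rule laplace_representative_exists)
  note D = orthant_laplace_fun_diff[OF F(1) G(1)]
  have FG: "ae_eq (\<lambda>t. J \<alpha> f t - J \<alpha> g t) (\<lambda>t. F t - G t)"
    using F(2) G(2) unfolding ae_eq_lborel by eventually_elim auto
  have "AE t in lborel. F t - G t = 0"
  proof (rule AE_zero_on_boxes[OF D])
    fix T :: "(real, 'n) vec" assume T: "T \<in> pos_orthant"
    have "ae_eq (\<lambda>t. f t - g t) (\<lambda>t. 0)" using fg unfolding ae_eq_lborel by eventually_elim auto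
    then have 0: "L1_norm T (\<lambda>t. f t - g t) = 0"
      by (subst L1_norm_representative[where F = "\<lambda>t. 0"]) (auto simp: orthant_laplace_fun_def)
    have "L1_norm T (\<lambda>t. J \<alpha> f t - J \<alpha> g t) \<le> \<epsilon>" if "\<epsilon> > 0" for \<epsilon>
      using L1_continuous[OF \<alpha> T that] f g 0 by (metis less_imp_le)
    then have "L1_norm T (\<lambda>t. J \<alpha> f t - J \<alpha> g t) \<le> 0" by (rule field_le_epsilon) simp
    then show "(\<integral>t. indicator (box 0 T) t * \<bar>F t - G t\<bar> \<partial>lborel) = 0"
      unfolding L1_norm_representative[OF D FG] by (intro antisym) auto
  qed
  with F(2) G(2) show ?thesis unfolding ae_eq_lborel by eventually_elim auto
qed

text \<open>The index law read in both orders, as addition of multiorders is commutative.\<close>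

lemma J_RL_commute:
  assumes \<alpha>: "\<alpha> \<in> nonneg_orthant" and f: "f \<in> laplace_transformable"
  shows "ae_eq (J \<alpha> (RL_coord i 1 f)) (RL_coord i 1 (J \<alpha> f))"
proof -
  have "ae_eq (RL_coord i 1 f) (J (axis i 1) f)"
    using identity[OF f, of i] by (simp add: riemann_liouville_axis ae_eq_sym)
  then have "ae_eq (J \<alpha> (RL_coord i 1 f)) (J \<alpha> (J (axis i 1) f))"
    by (rule J_cong[OF \<alpha>, rotated]) (rule RL_coord_laplace(1)[OF f], simp)
  also have "ae_eq \<dots> (J (\<alpha> + axis i 1) f)"
    by (rule ae_eq_sym[OF index_law[OF \<alpha> axis_nonneg_orthant f]])
  also have "\<alpha> + axis i 1 = axis i 1 + \<alpha>" by (rule add.commute)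
  also have "ae_eq (J (axis i 1 + \<alpha>) f) (J (axis i 1) (J \<alpha> f))"
    by (rule index_law[OF axis_nonneg_orthant \<alpha> f])
  also have "ae_eq \<dots> (RL_coord i 1 (J \<alpha> f))"
    using identity[OF maps_to[OF \<alpha> f], of i] by (simp add: riemann_liouville_axis)
  finally show ?thesis .
qed

definition J_factor :: "(real, 'n) vec \<Rightarrow> (real, 'n) vec \<Rightarrow> real" where
  "J_factor \<alpha> x = laplace (J \<alpha> (\<lambda>_. 1)) x / laplace (\<lambda>_. 1) x"

lemma laplace_J_one:
  "x \<in> pos_orthant \<Longrightarrow> laplace (J \<alpha> (\<lambda>_. 1)) x = J_factor \<alpha> x * laplace (\<lambda>_. 1) x"
  using laplace_const_one(2)[of x] by (simp add: J_factor_def)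

text \<open>Induction on the total degree. Moving \<open>J \<alpha>\<close> past one integration
  multiplies the transforms with and without \<open>J \<alpha>\<close> by the same power of
  \<open>x $ i\<close>, so their quotient stays the one of \<open>1\<close>.\<close>

lemma laplace_J_monomial:
  assumes \<alpha>: "\<alpha> \<in> nonneg_orthant" and x: "x \<in> pos_orthant"
  shows "monomial_fun k \<in> laplace_transformable \<and>
    laplace (J \<alpha> (monomial_fun k)) x = J_factor \<alpha> x * laplace (monomial_fun k) x"
proof (induction "\<Sum>i\<in>UNIV. k i" arbitrary: k)
  case 0
  then have "monomial_fun k = (\<lambda>_. 1)" by (simp add: fun_eq_iff monomial_fun_def)
  then show ?case using laplace_const_one(1) laplace_J_one[OF x] by simp
next
  case (Suc n)
  then have "(\<Sum>i\<in>UNIV. k i) \<noteq> 0" by linarith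
  then have "\<exists>i. k i \<noteq> 0" by (rule contrapos_np) simp
  then obtain i where i: "k i \<noteq> 0" by blast
  define k' where "k' = k(i := k i - 1)"
  have k: "k = k'(i := Suc (k' i))" using i by (simp add: k'_def fun_eq_iff)
  have "(\<Sum>i\<in>UNIV. k i) = Suc (\<Sum>i\<in>UNIV. k' i)"
    unfolding sum.remove[of UNIV i k, simplified] sum.remove[of UNIV i k', simplified]
    using i by (simp add: k'_def)
  with Suc(2) have n: "n = (\<Sum>i\<in>UNIV. k' i)" by simp
  note IH = Suc(1)[OF n]
  \<comment> \<open>The constant \<open>?c\<close> undoes the denominator that integration of a
    power produces.\<close>
  let ?m = "monomial_fun k' :: (real, 'n) vec \<Rightarrow> real" and ?c = "real (Suc (k' i))"
  have m: "?m \<in> laplace_transformable" using IH by simp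
  have R: "RL_coord i 1 ?m \<in> laplace_transformable"
    "x \<in> pos_orthant \<Longrightarrow> laplace (RL_coord i 1 ?m) x = x $ i powr - 1 * laplace ?m x"
    using RL_coord_laplace[OF m, where a = 1 and i = i] by simp_all
  have cR: "(\<lambda>t. ?c * RL_coord i 1 ?m t) \<in> laplace_transformable"
    by (rule laplace_transformable_scale[OF R(1)])
  have eq: "ae_eq (\<lambda>t. ?c * RL_coord i 1 ?m t) (monomial_fun k)"
    unfolding ae_eq_lborel by (rule AE_I2) (auto simp: RL_coord_monomial k)
  note M = laplace_cong[OF cR eq]
  have JR: "J \<alpha> (RL_coord i 1 ?m) \<in> laplace_transformable" by (rule maps_to[OF \<alpha> R(1)])
  have Jm: "J \<alpha> ?m \<in> laplace_transformable" by (rule maps_to[OF \<alpha> m])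
  have "laplace (J \<alpha> (monomial_fun k)) x = laplace (J \<alpha> (\<lambda>t. ?c * RL_coord i 1 ?m t)) x"
    by (rule laplace_cong(2)[OF maps_to[OF \<alpha> cR] J_cong[OF \<alpha> cR eq]])
  also have "\<dots> = laplace (\<lambda>t. ?c * J \<alpha> (RL_coord i 1 ?m) t) x"
    by (rule laplace_cong(2)[OF laplace_transformable_scale[OF JR] ae_eq_sym[OF homogeneous[OF \<alpha> R(1)]]])
  also have "\<dots> = ?c * laplace (J \<alpha> (RL_coord i 1 ?m)) x" by (rule laplace_scale)
  also have "laplace (J \<alpha> (RL_coord i 1 ?m)) x = laplace (RL_coord i 1 (J \<alpha> ?m)) x"
    by (rule laplace_cong(2)[OF RL_coord_laplace(1)[OF Jm] ae_eq_sym[OF J_RL_commute[OF \<alpha> m]]]) simp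
  also have "\<dots> = x $ i powr - 1 * laplace (J \<alpha> ?m) x" by (rule RL_coord_laplace(2)[OF Jm _ x]) simp
  also have "laplace (J \<alpha> ?m) x = J_factor \<alpha> x * laplace ?m x" using IH by simp
  also have "?c * (x $ i powr - 1 * (J_factor \<alpha> x * laplace ?m x)) = J_factor \<alpha> x * (?c * laplace (RL_coord i 1 ?m) x)"
    using R(2)[OF x] by simp
  also have "?c * laplace (RL_coord i 1 ?m) x = laplace (monomial_fun k) x"
    using M(2)[of x] laplace_scale[of ?c "RL_coord i 1 ?m" x] by simp
  finally show ?case using M(1) by simp
qed

lemma laplace_J_polynomial:
  assumes \<alpha>: "\<alpha> \<in> nonneg_orthant" and x: "x \<in> pos_orthant" and p: "monomial_span p"
  shows "p \<in> laplace_transformable \<and> laplace (J \<alpha> p) x = J_factor \<alpha> x * laplace p x"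
  using p
proof induction
  case (mono k) then show ?case by (rule laplace_J_monomial[OF \<alpha> x])
next
  case (add p q)
  then have p: "p \<in> laplace_transformable" and q: "q \<in> laplace_transformable" by auto
  note JJ = maps_to[OF \<alpha> p] maps_to[OF \<alpha> q]
  have "laplace (J \<alpha> (\<lambda>t. p t + q t)) x = laplace (\<lambda>t. J \<alpha> p t + J \<alpha> q t) x"
    by (rule laplace_cong(2)[OF laplace_transformable_add[OF JJ] ae_eq_sym[OF additive[OF \<alpha> p q]]])
  with add show ?case
    by (simp add: laplace_transformable_add[OF p q] laplace_add[OF p q x] laplace_add[OF JJ x] distrib_left)
next
  case (scale p c)
  then have p: "p \<in> laplace_transformable" by auto
  note Jp = maps_to[OF \<alpha> p]
  have "laplace (J \<alpha> (\<lambda>t. c * p t)) x = laplace (\<lambda>t. c * J \<alpha> p t) x"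
    by (rule laplace_cong(2)[OF laplace_transformable_scale[OF Jp] ae_eq_sym[OF homogeneous[OF \<alpha> p]]])
  with scale show ?case
    by (simp add: laplace_transformable_scale[OF p] laplace_scale)
qed

text \<open>
  Transforming, \<open>1 * J \<alpha> p = J \<alpha> 1 * p\<close> for polynomials \<open>p\<close>. Both sides depend on their argument continuously
  in mean on every box, so the identity extends to \<open>laplace_transformable\<close>.
\<close>
lemma laplace_J:
  assumes \<alpha>: "\<alpha> \<in> nonneg_orthant" and f: "f \<in> laplace_transformable" and x: "x \<in> pos_orthant"
  shows "laplace (J \<alpha> f) x = J_factor \<alpha> x * laplace f x"
proof -
  let ?I = "indicator pos_orthant :: (real, 'n) vec \<Rightarrow> real"
  note I = orthant_indicator
  have one: "ae_eq (\<lambda>_. 1) ?I" by (simp add: ae_eq_lborel)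
  have one_L: "(\<lambda>_ :: (real, 'n) vec. 1) \<in> laplace_transformable" by (rule laplace_const_one(1))
  obtain F where F: "F \<in> orthant_laplace_fun" "ae_eq f F" using f by (rule laplace_representative_exists)
  obtain E where E: "E \<in> orthant_laplace_fun" "ae_eq (J \<alpha> f) E"
    using maps_to[OF \<alpha> f] by (rule laplace_representative_exists)
  obtain G where G: "G \<in> orthant_laplace_fun" "ae_eq (J \<alpha> (\<lambda>_. 1)) G"
    using maps_to[OF \<alpha> one_L] by (rule laplace_representative_exists)
  note IE = conv_orthant_laplace_fun[OF I E(1)] and GF = conv_orthant_laplace_fun[OF G(1) F(1)]
  define D where "D t = conv ?I E t - conv G F t" for t
  have D: "D \<in> orthant_laplace_fun"
    unfolding D_def using orthant_laplace_fun_diff[OF IE(1) GF(1)] .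
  \<comment> \<open>Subtracting the identity for \<open>p\<close> writes \<open>D\<close> as the
    difference of the convolutions of \<open>1\<close> with \<open>E - Q\<close> and of
    \<open>G\<close> with \<open>F - P\<close>, so only the two approximation errors remain.\<close>
  have poly: "AE t in lborel. \<bar>D t\<bar> \<le> \<bar>conv ?I (\<lambda>t. E t - Q t) t\<bar> + \<bar>conv G (\<lambda>t. F t - P t) t\<bar>"
    if p: "monomial_span p" and P: "P \<in> orthant_laplace_fun" "ae_eq p P"
      and Q: "Q \<in> orthant_laplace_fun" "ae_eq (J \<alpha> p) Q" for p P Q
  proof -
    note IQ = conv_orthant_laplace_fun[OF I Q(1)] and GP = conv_orthant_laplace_fun[OF G(1) P(1)]
    have "AE t in lborel. conv ?I Q t - conv G P t = 0"
    proof (rule laplace_unique_zero[OF orthant_laplace_fun_diff[OF IQ(1) GP(1)]])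
      fix y :: "(real, 'n) vec" assume y: "y \<in> pos_orthant"
      have "(\<integral>t. (conv ?I Q t - conv G P t) * exp (- (t \<bullet> y)) \<partial>lborel) =
          (\<integral>t. conv ?I Q t * exp (- (t \<bullet> y)) \<partial>lborel) - (\<integral>t. conv G P t * exp (- (t \<bullet> y)) \<partial>lborel)"
        using IQ(1) GP(1) y by (simp add: orthant_laplace_fun_def left_diff_distrib)
      also have "\<dots> = laplace (\<lambda>_. 1) y * laplace (J \<alpha> p) y - laplace (J \<alpha> (\<lambda>_. 1)) y * laplace p y"
        unfolding IQ(2)[OF y] GP(2)[OF y] laplace_representative(2)[OF I one]
          laplace_representative(2)[OF Q] laplace_representative(2)[OF G] laplace_representative(2)[OF P] ..
      also have "\<dots> = 0"
        using laplace_J_polynomial[OF \<alpha> y p] laplace_J_one[OF y, of \<alpha>] by simp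
      finally show "(\<integral>t. (conv ?I Q t - conv G P t) * exp (- (t \<bullet> y)) \<partial>lborel) = 0" .
    qed
    with conv_diff[OF I E(1) Q(1)] conv_diff[OF G(1) F(1) P(1)]
    show ?thesis by eventually_elim (simp add: D_def)
  qed
  have "AE t in lborel. D t = 0"
  proof (rule AE_zero_on_boxes[OF D])
    fix T :: "(real, 'n) vec" assume T: "T \<in> pos_orthant"
    let ?B = "\<lambda>F. \<integral>t. indicator (box 0 T) t * \<bar>F t\<bar> \<partial>lborel"
    have B_nonneg: "?B F \<ge> 0" for F :: "(real, 'n) vec \<Rightarrow> real" by (intro integral_nonneg_AE) auto
    have abs_int: "integrable lborel (\<lambda>s. indicator (box 0 T) s * \<bar>H s\<bar>)" if "H \<in> orthant_laplace_fun" for H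
      using integrable_abs[OF integrable_on_box[OF that, of T]] by (simp add: abs_mult)
    have "?B D \<le> \<epsilon>" if \<epsilon>: "\<epsilon> > 0" for \<epsilon>
    proof -
      define bI where "bI = ?B ?I"
      define bG where "bG = ?B G"
      have b: "bI \<ge> 0" "bG \<ge> 0" unfolding bI_def bG_def by (rule B_nonneg)+
      \<comment> \<open>Each error gets half of \<open>\<epsilon>\<close>, divided by the box norm
        of its fixed factor; \<open>+ 1\<close> avoids division by zero. The bound
        \<open>\<epsilon>1\<close> on \<open>J \<alpha> f - J \<alpha> p\<close> is reached through
        continuity, \<open>\<epsilon>2\<close> on \<open>f - p\<close> directly, so \<open>p\<close>
        must be within both \<open>\<delta>\<close> and \<open>\<epsilon>2\<close>.\<close>
      define \<epsilon>1 where "\<epsilon>1 = \<epsilon> / 2 / (bI + 1)"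
      define \<epsilon>2 where "\<epsilon>2 = \<epsilon> / 2 / (bG + 1)"
      have pos: "\<epsilon>1 > 0" "\<epsilon>2 > 0"
        using \<epsilon> b by (auto simp: \<epsilon>1_def \<epsilon>2_def intro!: divide_pos_pos)
      obtain \<delta> where \<delta>: "\<delta> > 0" "\<And>f1 f2. f1 \<in> laplace_transformable \<Longrightarrow> f2 \<in> laplace_transformable \<Longrightarrow>
          L1_norm T (\<lambda>t. f1 t - f2 t) < \<delta> \<Longrightarrow> L1_norm T (\<lambda>t. J \<alpha> f1 t - J \<alpha> f2 t) < \<epsilon>1"
        using L1_continuous[OF \<alpha> T pos(1)] by blast
      obtain p where p: "monomial_span p" "(\<integral>t. indicator (box 0 T) t * \<bar>F t - p t\<bar> \<partial>lborel) < min \<delta> \<epsilon>2"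
        using polynomial_dense_on_box[OF F(1), of "min \<delta> \<epsilon>2" T] \<delta>(1) pos(2) by auto
      have pL: "p \<in> laplace_transformable" using laplace_J_polynomial[OF \<alpha> x p(1)] by simp
      have p_meas: "p \<in> borel_measurable borel"
        using p(1)
        by induction (auto simp: monomial_fun_def[abs_def])
      obtain P0 where P0: "P0 \<in> orthant_laplace_fun" "ae_eq p P0" using pL by (rule laplace_representative_exists)
      obtain Q where Q: "Q \<in> orthant_laplace_fun" "ae_eq (J \<alpha> p) Q"
        using maps_to[OF \<alpha> pL] by (rule laplace_representative_exists)
      note FP = orthant_laplace_fun_diff[OF F(1) P0(1)] and EQ = orthant_laplace_fun_diff[OF E(1) Q(1)]
      have "ae_eq (\<lambda>t. f t - p t) (\<lambda>t. F t - P0 t)"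
        using F(2) P0(2) unfolding ae_eq_lborel by eventually_elim auto
      note L1_fp = L1_norm_representative[OF FP this, of T]
      have "ae_eq (\<lambda>t. J \<alpha> f t - J \<alpha> p t) (\<lambda>t. E t - Q t)"
        using E(2) Q(2) unfolding ae_eq_lborel by eventually_elim auto
      note L1_Jfp = L1_norm_representative[OF EQ this, of T]
      have fp: "?B (\<lambda>t. F t - P0 t) < min \<delta> \<epsilon>2"
      proof -
        have "?B (\<lambda>t. F t - P0 t) = ?B (\<lambda>t. F t - p t)"
        proof (rule integral_cong_AE)
          show "AE t in lborel. indicator (box 0 T) t * \<bar>F t - P0 t\<bar> = indicator (box 0 T) t * \<bar>F t - p t\<bar>"
            using P0(2)[unfolded ae_eq_lborel]
            by eventually_elim (use box_subset_pos_orthant[of T] in \<open>auto simp: indicator_def\<close>)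
        qed (use F(1) P0(1) p_meas in \<open>auto simp: orthant_laplace_fun_def\<close>)
        with p(2) show ?thesis by simp
      qed
      then have Jfp: "?B (\<lambda>t. E t - Q t) < \<epsilon>1"
        using \<delta>(2)[OF f pL] by (simp add: L1_fp L1_Jfp)
      note IEQ = conv_orthant_laplace_fun(1)[OF I EQ] and GFP = conv_orthant_laplace_fun(1)[OF G(1) FP]
      have "?B D \<le> (\<integral>t. indicator (box 0 T) t * \<bar>conv ?I (\<lambda>t. E t - Q t) t\<bar> +
          indicator (box 0 T) t * \<bar>conv G (\<lambda>t. F t - P0 t) t\<bar> \<partial>lborel)"
        using poly[OF p(1) P0 Q] abs_int[OF D] abs_int[OF IEQ] abs_int[OF GFP]
        by (intro integral_mono_AE) (auto simp: indicator_def elim!: eventually_mono)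
      also have "\<dots> = ?B (conv ?I (\<lambda>t. E t - Q t)) + ?B (conv G (\<lambda>t. F t - P0 t))"
        using abs_int[OF IEQ] abs_int[OF GFP] by (rule Bochner_Integration.integral_add)
      also have "\<dots> \<le> bI * ?B (\<lambda>t. E t - Q t) + bG * ?B (\<lambda>t. F t - P0 t)"
        unfolding bI_def bG_def by (intro add_mono conv_box_bound I G EQ FP)
      also have "\<dots> \<le> bI * \<epsilon>1 + bG * \<epsilon>2"
        using Jfp fp b by (intro add_mono mult_left_mono) auto
      also have "\<dots> \<le> (bI + 1) * \<epsilon>1 + (bG + 1) * \<epsilon>2"
        using pos by (intro add_mono mult_right_mono) auto
      also have "\<dots> = \<epsilon>"
      proof -
        have "(bI + 1) * \<epsilon>1 = \<epsilon> / 2" "(bG + 1) * \<epsilon>2 = \<epsilon> / 2"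
          using b by (simp_all add: \<epsilon>1_def \<epsilon>2_def field_simps)
        then show ?thesis by simp
      qed
      finally show ?thesis .
    qed
    then have "?B D \<le> 0" by (rule field_le_epsilon) simp
    then show "?B D = 0" using B_nonneg[of D] by simp
  qed
  then have eq: "AE t in lborel. conv ?I E t * exp (- (t \<bullet> x)) = conv G F t * exp (- (t \<bullet> x))"
    by eventually_elim (simp add: D_def)
  have "(\<integral>t. conv ?I E t * exp (- (t \<bullet> x)) \<partial>lborel) = (\<integral>t. conv G F t * exp (- (t \<bullet> x)) \<partial>lborel)"
    using IE(1) GF(1) x by (intro integral_cong_AE eq) (auto simp: orthant_laplace_fun_def borel_measurable_integrable)
  then have "laplace (\<lambda>_. 1) x * laplace (J \<alpha> f) x = laplace (J \<alpha> (\<lambda>_. 1)) x * laplace f x"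
    unfolding IE(2)[OF x] GF(2)[OF x] laplace_representative(2)[OF I one]
      laplace_representative(2)[OF E] laplace_representative(2)[OF G] laplace_representative(2)[OF F] .
  then show ?thesis using laplace_const_one(2)[OF x] by (simp add: J_factor_def field_simps)
qed

text \<open>The index law leads to \<open>J \<alpha>\<close> applied to \<open>J \<beta> 1\<close>,
  in general not a polynomial, so the full \<open>laplace_J\<close> is required.\<close>

lemma J_factor_add:
  assumes \<alpha>: "\<alpha> \<in> nonneg_orthant" and \<beta>: "\<beta> \<in> nonneg_orthant" and x: "x \<in> pos_orthant"
  shows "J_factor (\<alpha> + \<beta>) x = J_factor \<alpha> x * J_factor \<beta> x"
proof -
  let ?g = "J \<beta> (\<lambda>_. 1)"
  have g: "?g \<in> laplace_transformable" by (rule maps_to[OF \<beta> laplace_const_one(1)])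
  have "laplace (J (\<alpha> + \<beta>) (\<lambda>_. 1)) x = laplace (J \<alpha> ?g) x"
    by (rule laplace_cong(2)[OF maps_to[OF \<alpha> g] ae_eq_sym[OF index_law[OF \<alpha> \<beta> laplace_const_one(1)]]])
  also have "\<dots> = J_factor \<alpha> x * laplace ?g x" by (rule laplace_J[OF \<alpha> g x])
  finally show ?thesis by (simp add: J_factor_def)
qed

lemma J_factor_axis:
  assumes x: "x \<in> pos_orthant"
  shows "J_factor (axis i 1) x = inverse (x $ i)"
proof -
  note one = laplace_const_one(1)
  have xi: "0 < x $ i" using x by (simp add: pos_orthant_def)
  have R: "RL_coord i 1 (\<lambda>_. 1) \<in> laplace_transformable"
    by (rule RL_coord_laplace(1)[OF one]) simp
  have "ae_eq (RL_coord i 1 (\<lambda>_. 1)) (J (axis i 1) (\<lambda>_. 1))"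
    using identity[OF one, of i] by (simp add: riemann_liouville_axis ae_eq_sym)
  then have "laplace (J (axis i 1) (\<lambda>_. 1)) x = laplace (RL_coord i 1 (\<lambda>_. 1)) x"
    by (rule laplace_cong(2)[OF R])
  also have "\<dots> = x $ i powr - 1 * laplace (\<lambda>_. 1) x"
    by (rule RL_coord_laplace(2)[OF one _ x]) simp
  also have "x $ i powr - 1 = inverse (x $ i)" using xi by (simp add: powr_minus)
  finally show ?thesis using laplace_const_one(2)[OF x] by (simp add: J_factor_def)
qed

lemma scaled_axis_nonneg: "0 \<le> c \<Longrightarrow> c *\<^sub>R axis i 1 \<in> (nonneg_orthant :: (real, 'n) vec set)"
  by (simp add: nonneg_orthant_def axis_def)

lemma J_factor_product:
  assumes \<alpha>: "\<alpha> \<in> nonneg_orthant" and x: "x \<in> pos_orthant"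
  shows "J_factor \<alpha> x = (\<Prod>i\<in>UNIV. J_factor (\<alpha> $ i *\<^sub>R axis i 1) x)"
proof -
  have "(\<Sum>i\<in>A. \<alpha> $ i *\<^sub>R axis i 1) \<in> nonneg_orthant \<and>
      J_factor (\<Sum>i\<in>A. \<alpha> $ i *\<^sub>R axis i 1) x = (\<Prod>i\<in>A. J_factor (\<alpha> $ i *\<^sub>R axis i 1) x)" if "finite A" for A
    using that
  proof (induction A)
    case empty
    \<comment> \<open>That \<open>J 0\<close> has factor \<open>1\<close> is not assumed; it follows
      by cancelling the nonzero factor of an axis vector.\<close>
    fix i :: 'n
    have z: "(0 :: (real, 'n) vec) \<in> nonneg_orthant" by (simp add: nonneg_orthant_def)
    have "0 < x $ i" using x by (simp add: pos_orthant_def)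
    then have "J_factor (axis i 1) x \<noteq> 0" by (simp add: J_factor_axis[OF x])
    moreover have "J_factor (axis i 1) x = J_factor (axis i 1) x * J_factor 0 x"
      using J_factor_add[OF axis_nonneg_orthant z x, of i] by simp
    ultimately show ?case using z by simp
  next
    case (insert i A)
    have "\<alpha> $ i *\<^sub>R axis i 1 \<in> nonneg_orthant"
      using \<alpha> by (intro scaled_axis_nonneg) (simp add: nonneg_orthant_def)
    with insert show ?case using x by (simp add: J_factor_add) (simp add: nonneg_orthant_def)
  qed
  from this[of UNIV] show ?thesis by (simp add: basis_expansion scalar_mult_eq_scaleR[symmetric])
qed

text \<open>By multiplicativity the factor at \<open>s *\<^sub>R axis i 1\<close> is the quotient of
  those at \<open>\<alpha>0 + s *\<^sub>R axis i 1\<close> and \<open>\<alpha>0\<close>. Continuity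
  at \<open>\<alpha>0\<close> thus becomes a one-sided limit at \<open>0\<close> on each axis, and
  \<open>multiplicative_powr\<close> applies with value \<open>inverse (x $ i)\<close> at
  \<open>1\<close>.\<close>

lemma J_factor_eq:
  assumes x: "x \<in> pos_orthant" and \<alpha>0: "\<alpha>0 \<in> pos_orthant" and \<alpha>: "\<alpha> \<in> nonneg_orthant"
    and cont: "continuous (at \<alpha>0 within pos_orthant) (\<lambda>\<alpha>. laplace (J \<alpha> (\<lambda>_. 1)) x)"
  shows "J_factor \<alpha> x = (\<Prod>i\<in>UNIV. x $ i powr - (\<alpha> $ i))"
proof -
  have xi: "x $ i > 0" for i using x by (simp add: pos_orthant_def)
  have \<alpha>0': "\<alpha>0 \<in> nonneg_orthant" using \<alpha>0 by (auto simp: pos_orthant_def nonneg_orthant_def less_imp_le)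
  have mult: "J_factor ((a + b) *\<^sub>R axis i 1) x = J_factor (a *\<^sub>R axis i 1) x * J_factor (b *\<^sub>R axis i 1) x"
    if "a \<ge> 0" "b \<ge> 0" for a b and i :: 'n
    using J_factor_add[OF scaled_axis_nonneg[OF that(1)] scaled_axis_nonneg[OF that(2)] x] by (simp add: scaleR_add_left)
  have one: "J_factor (1 *\<^sub>R axis i 1) x > 0" for i using xi by (simp add: J_factor_axis[OF x])
  have pos: "J_factor (c *\<^sub>R axis i 1) x > 0" if "c \<ge> 0" for c and i :: 'n
    using multiplicative_pos[of "\<lambda>c. J_factor (c *\<^sub>R axis i 1) x" c, OF mult one that] .
  \<comment> \<open>Positivity is algebraic and precedes any use of continuity; it permits division
    at \<open>\<alpha>0\<close>.\<close>
  have h0: "J_factor \<alpha>0 x > 0"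
    unfolding J_factor_product[OF \<alpha>0' x] using \<alpha>0' by (intro prod_pos ballI pos) (simp add: nonneg_orthant_def)
  have "((\<lambda>\<alpha>. J_factor \<alpha> x) \<longlongrightarrow> J_factor \<alpha>0 x) (at \<alpha>0 within pos_orthant)"
    unfolding J_factor_def using cont laplace_const_one(2)[OF x]
    by (intro tendsto_divide tendsto_const) (auto simp: continuous_within)
  then have h_lim: "((\<lambda>\<alpha>. J_factor \<alpha> x / J_factor \<alpha>0 x) \<longlongrightarrow> 1) (at \<alpha>0 within pos_orthant)"
    using tendsto_divide[OF _ tendsto_const, of _ "J_factor \<alpha>0 x" _ "J_factor \<alpha>0 x"] h0 by fastforce
  have lim: "((\<lambda>s. J_factor (s *\<^sub>R axis i 1) x) \<longlongrightarrow> 1) (at_right 0)" for i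
  proof -
    have "filterlim (\<lambda>s. \<alpha>0 + s *\<^sub>R axis i 1) (at \<alpha>0 within pos_orthant) (at_right 0)"
      unfolding filterlim_at
    proof
      have "\<alpha>0 + s *\<^sub>R axis i 1 \<in> pos_orthant \<and> \<alpha>0 + s *\<^sub>R axis i 1 \<noteq> \<alpha>0" if "s > 0" for s
      proof
        have "0 < \<alpha>0 $ j \<and> 0 \<le> (s *\<^sub>R axis i (1::real)) $ j" for j
          using \<alpha>0 that by (simp add: pos_orthant_def axis_def)
        then show "\<alpha>0 + s *\<^sub>R axis i 1 \<in> pos_orthant"
          unfolding pos_orthant_def by (simp add: add_pos_nonneg)
        show "\<alpha>0 + s *\<^sub>R axis i 1 \<noteq> \<alpha>0" using that by (simp add: axis_eq_0_iff)
      qed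
      then show "\<forall>\<^sub>F s in at_right 0. \<alpha>0 + s *\<^sub>R axis i 1 \<in> pos_orthant \<and> \<alpha>0 + s *\<^sub>R axis i 1 \<noteq> \<alpha>0"
        by (intro eventually_at_rightI[of 0 1]) auto
      have "((\<lambda>s. \<alpha>0 + s *\<^sub>R axis i 1) \<longlongrightarrow> \<alpha>0 + 0 *\<^sub>R axis i 1) (at_right 0)"
        by (intro tendsto_intros)
      then show "((\<lambda>s. \<alpha>0 + s *\<^sub>R axis i 1) \<longlongrightarrow> \<alpha>0) (at_right 0)" by simp
    qed
    from filterlim_compose[OF h_lim this]
    have "((\<lambda>s. J_factor (\<alpha>0 + s *\<^sub>R axis i 1) x / J_factor \<alpha>0 x) \<longlongrightarrow> 1) (at_right 0)" .
    moreover have "\<forall>\<^sub>F s in at_right 0. J_factor (\<alpha>0 + s *\<^sub>R axis i 1) x / J_factor \<alpha>0 x = J_factor (s *\<^sub>R axis i 1) x"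
      using h0 by (intro eventually_at_rightI[of 0 1]) (simp_all add: J_factor_add[OF \<alpha>0' scaled_axis_nonneg x])
    ultimately show ?thesis by (rule Lim_transform_eventually)
  qed
  have "J_factor (\<alpha> $ i *\<^sub>R axis i 1) x = x $ i powr - (\<alpha> $ i)" for i
  proof -
    have "\<alpha> $ i \<ge> 0" using \<alpha> by (simp add: nonneg_orthant_def)
    from multiplicative_powr[of "\<lambda>c. J_factor (c *\<^sub>R axis i 1) x", OF mult one lim this]
    have "J_factor (\<alpha> $ i *\<^sub>R axis i 1) x = inverse (x $ i) powr (\<alpha> $ i)" by (simp only: scaleR_one J_factor_axis[OF x])
    also have "\<dots> = x $ i powr - (\<alpha> $ i)" using xi[of i] by (simp add: powr_def ln_inverse)
    finally show ?thesis .
  qed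
  then show ?thesis unfolding J_factor_product[OF \<alpha> x] by simp
qed

end

theorem theorem5p4:
  fixes J :: "(real, 'n::{finite, linorder}) vec \<Rightarrow> ((real, 'n) vec \<Rightarrow> real) \<Rightarrow> ((real, 'n) vec \<Rightarrow> real)"
  assumes "CARD('n) > 1"
    and maps_to: "\<And>\<alpha> f. \<lbrakk>\<alpha> \<in> nonneg_orthant; f \<in> laplace_transformable\<rbrakk>
          \<Longrightarrow> J \<alpha> f \<in> laplace_transformable"
    and additive: "\<And>\<alpha> f g. \<lbrakk>\<alpha> \<in> nonneg_orthant; f \<in> laplace_transformable; g \<in> laplace_transformable\<rbrakk>
          \<Longrightarrow> ae_eq (J \<alpha> (\<lambda>t. f t + g t)) (\<lambda>t. J \<alpha> f t + J \<alpha> g t)"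
    and homogeneous: "\<And>\<alpha> f c. \<lbrakk>\<alpha> \<in> nonneg_orthant; f \<in> laplace_transformable\<rbrakk>
          \<Longrightarrow> ae_eq (J \<alpha> (\<lambda>t. c * f t)) (\<lambda>t. c * J \<alpha> f t)"
    and L1_continuous: "\<And>\<alpha> T \<epsilon>. \<lbrakk>\<alpha> \<in> nonneg_orthant; T \<in> pos_orthant; \<epsilon> > 0\<rbrakk>
          \<Longrightarrow> \<exists>\<delta>>0. \<forall>f1\<in>laplace_transformable. \<forall>f2\<in>laplace_transformable.
                L1_norm T (\<lambda>t. f1 t - f2 t) < \<delta> \<longrightarrow> L1_norm T (\<lambda>t. J \<alpha> f1 t - J \<alpha> f2 t) < \<epsilon>"
    and identity: "\<And>i f. f \<in> laplace_transformable
          \<Longrightarrow> ae_eq (J (axis i 1) f) (riemann_liouville (axis i 1) f)"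
    and index_law: "\<And>\<alpha> \<beta> f. \<lbrakk>\<alpha> \<in> nonneg_orthant; \<beta> \<in> nonneg_orthant; f \<in> laplace_transformable\<rbrakk>
          \<Longrightarrow> ae_eq (J (\<alpha> + \<beta>) f) (J \<alpha> (J \<beta> f))"
    and continuity: "\<And>x. x \<in> pos_orthant
          \<Longrightarrow> \<exists>\<alpha>\<^sub>0\<in>pos_orthant.
                continuous (at \<alpha>\<^sub>0 within pos_orthant) (\<lambda>\<alpha>. laplace (J \<alpha> (\<lambda>_. 1)) x)"
  shows "\<forall>\<alpha>\<in>nonneg_orthant. \<forall>f\<in>laplace_transformable. ae_eq (J \<alpha> f) (riemann_liouville \<alpha> f)"
proof (intro ballI)
  fix \<alpha> :: "(real, 'n) vec" and f :: "(real, 'n) vec \<Rightarrow> real"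
  assume \<alpha>: "\<alpha> \<in> nonneg_orthant" and f: "f \<in> laplace_transformable"
  interpret fractional_family J
  proof (unfold_locales, goal_cases)
    case 1 then show ?case by (rule maps_to)
  next
    case 2 then show ?case by (rule additive)
  next
    case 3 then show ?case by (rule homogeneous)
  next
    case 4 then show ?case by (rule L1_continuous)
  next
    case 5 then show ?case by (rule identity)
  next
    case 6 then show ?case by (rule index_law)
  qed
  show "ae_eq (J \<alpha> f) (riemann_liouville \<alpha> f)"
  proof (rule laplace_unique[OF maps_to[OF \<alpha> f] riemann_liouville_laplace(1)[OF f \<alpha>]])
    fix x :: "(real, 'n) vec" assume x: "x \<in> pos_orthant"
    \<comment> \<open>The point of continuity is chosen for this \<open>x\<close> alone; uniqueness
      only compares the transforms one \<open>x\<close> at a time.\<close>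
    obtain \<alpha>0 where \<alpha>0: "\<alpha>0 \<in> pos_orthant"
      "continuous (at \<alpha>0 within pos_orthant) (\<lambda>\<alpha>. laplace (J \<alpha> (\<lambda>_. 1)) x)"
      using continuity[OF x] by blast
    show "laplace (J \<alpha> f) x = laplace (riemann_liouville \<alpha> f) x"
      unfolding laplace_J[OF \<alpha> f x] J_factor_eq[OF x \<alpha>0(1) \<alpha> \<alpha>0(2)] riemann_liouville_laplace(2)[OF f \<alpha> x] ..
  qed
qed

end
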